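(* Let $N\geq 1$ be an integer and let $a\in\mathbb R$ satisfy $-N<a<1$ and $a\neq 0$. Then there exists a constant $C_{N,a}>0$, depending only on $N$ and $a$, such that $$\int_{\mathbb R^N}\left|\nabla\left(\frac{u(x)}{|x|}\right)\right|^N|x|^a\,\mathrm dx\leq C_{N,a}\int_{\mathbb R^N}\left|\Delta u(x)\right|^N|x|^a\,\mathrm dx$$ for all $u\in C^\infty_c(\mathbb R^N\setminus\{0\})$.
   Context: $C^\infty_c(\mathbb R^N\setminus\{0\})$ denotes the smooth real-valued functions whose support is a compact subset of $\mathbb R^N\setminus\{0\}$. $|x|$ is the Euclidean norm and $\Delta$ is the Laplacian on $\mathbb R^N$. *)

theory Defs
  imports "HOL-Analysis.Analysis"
begin

text \<open>
  A function is \<open>C\<^sup>0\<close> if it is continuous, and \<open>C\<^sup>k\<^sup>+\<^sup>1\<close> if it is differentiable everywhere and each of its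
  directional derivatives is \<open>C\<^sup>k\<close>. In finite dimension the directions may equivalently be restricted
  to a basis, which gives the usual definition through continuous partial derivatives.
\<close>

primrec C_diff :: "nat \<Rightarrow> ('a::real_normed_vector \<Rightarrow> 'b::real_normed_vector) \<Rightarrow> bool" where
  "C_diff 0 f \<longleftrightarrow> continuous_on UNIV f"
| "C_diff (Suc k) f \<longleftrightarrow>
     (\<forall>x. f differentiable (at x)) \<and> (\<forall>v. C_diff k (\<lambda>x. frechet_derivative f (at x) v))"

definition smooth :: "('a::real_normed_vector \<Rightarrow> 'b::real_normed_vector) \<Rightarrow> bool" where
  "smooth f \<longleftrightarrow> (\<forall>k. C_diff k f)"

text \<open>
  \<open>C\<^sub>c\<^sup>\<infinity>(\<real>\<^sup>N \<setminus> {0})\<close>, where a function on the punctured space is identified with its extension by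
  zero to the origin. The support is the closure taken in the whole space; since it is required
  to avoid the origin, \<open>u\<close> vanishes in a neighbourhood of \<open>0\<close>.
\<close>

definition punctured_test_functions :: "(real ^ 'n \<Rightarrow> real) set" where
  "punctured_test_functions =
     {u. smooth u \<and> compact (closure (support_on UNIV u)) \<and> 0 \<notin> closure (support_on UNIV u)}"

definition partial_deriv :: "'n \<Rightarrow> (real ^ 'n \<Rightarrow> real) \<Rightarrow> real ^ 'n \<Rightarrow> real" where
  "partial_deriv i f x = frechet_derivative f (at x) (axis i 1)"

definition gradient :: "(real ^ 'n \<Rightarrow> real) \<Rightarrow> real ^ 'n \<Rightarrow> real ^ 'n" where
  "gradient f x = (\<chi> i. partial_deriv i f x)"

definition laplacian :: "(real ^ 'n \<Rightarrow> real) \<Rightarrow> real ^ 'n \<Rightarrow> real" where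
  "laplacian f x = (\<Sum>i\<in>UNIV. partial_deriv i (partial_deriv i f) x)"

end

theory Submission
  imports Defs
begin

text \<open>
  Since \<open>\<nabla>(u/\<bar>x\<bar>)\<close> is bounded by \<open>\<bar>\<nabla>u\<bar>/\<bar>x\<bar> + \<bar>u\<bar>/\<bar>x\<bar>\<^sup>2\<close> and the second term is controlled by the first through
  Hardy's inequality (its critical exponent is \<open>a = N\<close>), it suffices to bound \<open>\<nabla>u/\<bar>x\<bar>\<close> by \<open>\<Delta>u\<close> in the weighted
  \<open>L\<^sup>N\<close> norm. For \<open>N = 1\<close> this is Hardy's inequality for \<open>u'\<close>, which needs \<open>a \<noteq> 0\<close>. For \<open>N \<ge> 2\<close>, \<open>\<nabla>u\<close> is the
  convolution of \<open>\<Delta>u\<close> with a multiple of \<open>z/\<bar>z\<bar>\<^sup>N\<close>. If \<open>a > 0\<close>, the kernel is bounded by \<open>\<bar>x - y\<bar>\<close> to the power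
  \<open>1 - N\<close>; if \<open>a < 0\<close>, one subtracts its value at \<open>x = 0\<close>, using \<open>\<nabla>u(0) = 0\<close>. In both cases the weighted
  kernel is homogeneous of degree \<open>-N\<close>, and Schur's test with power weights applies. No second
  derivatives of \<open>u\<close> other than \<open>\<Delta>u\<close> are estimated, so singular integrals do not occur.
\<close>

section \<open>Change of variables and radial integrals\<close>

text \<open>The sign of \<open>a\<close> decides the kernel because of the exponents open to Schur's
  test, which are tied by \<open>a = \<sigma> * (N - 1) - \<tau>\<close>. For the kernel |x|^-1 |x -
  y|^(1 - N) the two test integrals converge for 1 < \<sigma> < N and 0 < \<tau> < N - 1, so only
  positive a are reached. Subtracting the kernel value at the origin buys one more order of decay in
  y and moves the windows to 0 < \<sigma> < 1 and N - 1 < \<tau> < N, which sweep out exactly -N < a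
  < 0. The value a = 0 is the common endpoint. The kernel is used in the form z (|z|^2 +
  \<epsilon>^2)^(-N/2). It is smooth across the singularity, so integration by parts takes place on
  the whole space, without excised balls or boundary terms, and an approximate identity recovers the
  gradient as \<epsilon> tends to 0. All bounds on the kernel are uniform in \<epsilon>, so they
  pass to the limit. No sharp constant is sought, which is why integrals of powers are estimated
  over dyadic shells.\<close>

lemma nn_integral_lborel_affine:
  fixes f :: "'a::euclidean_space \<Rightarrow> ennreal"
  assumes [measurable]: "f \<in> borel_measurable borel" and "c \<noteq> 0"
  shows "(\<integral>\<^sup>+x. f x \<partial>lborel) = ennreal (\<bar>c\<bar> ^ DIM('a)) * (\<integral>\<^sup>+x. f (t + c *\<^sub>R x) \<partial>lborel)"
  using \<open>c \<noteq> 0\<close>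
  by (subst lborel_affine[of c t]) (simp_all add: nn_integral_density nn_integral_distr nn_integral_cmult)

lemma lborel_integral_affine:
  fixes f :: "'a::euclidean_space \<Rightarrow> real"
  assumes [measurable]: "f \<in> borel_measurable borel" and "c \<noteq> 0"
  shows "(\<integral>x. f x \<partial>lborel) = \<bar>c\<bar> ^ DIM('a) * (\<integral>x. f (t + c *\<^sub>R x) \<partial>lborel)"
  using \<open>c \<noteq> 0\<close>
  by (subst lborel_affine[of c t]) (simp_all add: integral_density integral_distr)

lemma ex_dyadic_scale:
  fixes x :: real
  assumes "1 \<le> x"
  shows "\<exists>k::nat. 2 ^ k \<le> x \<and> x < 2 ^ Suc k"
proof -
  obtain n where n: "x < 2 ^ n" using real_arch_pow[of 2 x] by auto
  define m where "m = (LEAST n. x < 2 ^ n)"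
  have m: "x < 2 ^ m" unfolding m_def by (rule LeastI[of _ n]) (rule n)
  have "m \<noteq> 0" using m assms by (intro notI) auto
  then obtain k where k: "m = Suc k" by (cases m) auto
  have "\<not> x < 2 ^ k" using not_less_Least[of k "\<lambda>n. x < 2 ^ n"] k m_def by auto
  then show ?thesis using m k by (intro exI[of _ k]) auto
qed

text \<open>Dyadic shells take the place of polar coordinates: on the shell with inner radius
  \<theta>^k r the integrand is at most its value there, and the shell lies in a ball of known
  volume. What remains is a geometric series of ratio \<open>\<theta> powr (N - \<mu>)\<close>.
  Leaving \<theta> free serves both ends: \<theta> = 1/2 shrinks the shells to the origin, \<theta>
  = 2 sends them to infinity.\<close>

lemma nn_integral_norm_powr_dyadic:
  fixes S :: "'a::euclidean_space set" and \<mu> \<theta> r :: real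
  assumes "0 \<le> \<mu>" "0 < \<theta>" "\<theta> powr (real DIM('a) - \<mu>) < 1" "0 < r"
    and S: "\<And>y. y \<in> S \<Longrightarrow> \<exists>k::nat. \<theta> ^ k * r \<le> norm y \<and> norm y \<le> 2 * (\<theta> ^ k * r)"
  shows "(\<integral>\<^sup>+y. indicator S y * ennreal (norm y powr - \<mu>) \<partial>lborel)
    \<le> ennreal (2 ^ DIM('a) * unit_ball_vol DIM('a) / (1 - \<theta> powr (real DIM('a) - \<mu>)) * r powr (real DIM('a) - \<mu>))"
proof -
  let ?N = "DIM('a)"
  define \<rho> where "\<rho> k = \<theta> ^ k * r" for k
  have \<rho>: "\<rho> k > 0" for k using assms by (simp add: \<rho>_def)
  define c where "c k = \<rho> k powr - \<mu>" for k
  define V where "V = unit_ball_vol (real ?N)"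
  have "indicator S y * ennreal (norm y powr - \<mu>)
      \<le> (\<Sum>k. ennreal (c k) * indicator (cball 0 (2 * \<rho> k)) y)" for y :: 'a
  proof (cases "y \<in> S")
    case True
    then obtain k where k: "\<rho> k \<le> norm y" "norm y \<le> 2 * \<rho> k" using S \<rho>_def by metis
    have "ennreal (norm y powr - \<mu>) \<le> ennreal (c k)"
      using k \<rho>[of k] assms(1) by (auto simp: c_def intro!: ennreal_leI powr_mono2')
    also have "\<dots> = (\<Sum>i\<in>{k}. ennreal (c i) * indicator (cball 0 (2 * \<rho> i)) y)"
      using k by simp
    also have "\<dots> \<le> (\<Sum>k. ennreal (c k) * indicator (cball 0 (2 * \<rho> k)) y)"
      by (rule sum_le_suminf) auto
    finally show ?thesis using True by simp
  qed simp
  then have "(\<integral>\<^sup>+y. indicator S y * ennreal (norm y powr - \<mu>) \<partial>lborel)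
      \<le> (\<integral>\<^sup>+y. (\<Sum>k. ennreal (c k) * indicator (cball 0 (2 * \<rho> k)) (y::'a)) \<partial>lborel)"
    by (intro nn_integral_mono) auto
  also have "\<dots> = (\<Sum>k. \<integral>\<^sup>+y. ennreal (c k) * indicator (cball 0 (2 * \<rho> k)) (y::'a) \<partial>lborel)"
    by (intro nn_integral_suminf borel_measurable_times_ennreal borel_measurable_const borel_measurable_indicator)
      (simp_all add: borel_closed)
  also have "\<dots> = (\<Sum>k. ennreal (c k * (V * (2 * \<rho> k) ^ ?N)))"
  proof (rule suminf_cong)
    fix k
    have "emeasure lborel (cball (0::'a) (2 * \<rho> k)) = ennreal (V * (2 * \<rho> k) ^ ?N)"
      using emeasure_cball[of "2 * \<rho> k" "0::'a"] \<rho>[of k] by (simp add: V_def)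
    then show "(\<integral>\<^sup>+y. ennreal (c k) * indicator (cball 0 (2 * \<rho> k)) (y::'a) \<partial>lborel)
        = ennreal (c k * (V * (2 * \<rho> k) ^ ?N))"
      by (subst nn_integral_cmult_indicator) (simp_all add: borel_closed c_def flip: ennreal_mult')
  qed
  also have "\<dots> = (\<Sum>k. ennreal (2 ^ ?N * V * r powr (?N - \<mu>) * (\<theta> powr (?N - \<mu>)) ^ k))"
  proof (intro suminf_cong arg_cong[of _ _ ennreal])
    fix k
    have "\<rho> k powr - \<mu> * \<rho> k ^ ?N = \<rho> k powr (?N - \<mu>)"
      using \<rho>[of k] by (simp add: powr_realpow[symmetric] powr_add[symmetric])
    moreover have "\<rho> k powr (?N - \<mu>) = (\<theta> powr (?N - \<mu>)) ^ k * r powr (?N - \<mu>)"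
      using assms by (simp add: \<rho>_def powr_mult powr_power powr_realpow[symmetric] powr_powr mult.commute)
    ultimately show "c k * (V * (2 * \<rho> k) ^ ?N) = 2 ^ ?N * V * r powr (?N - \<mu>) * (\<theta> powr (?N - \<mu>)) ^ k"
      by (simp add: c_def power_mult_distrib)
  qed
  also have "\<dots> = ennreal (2 ^ ?N * V * r powr (?N - \<mu>) * (1 / (1 - \<theta> powr (?N - \<mu>))))"
  proof (rule suminf_ennreal_eq)
    show "(\<lambda>k. 2 ^ ?N * V * r powr (?N - \<mu>) * (\<theta> powr (?N - \<mu>)) ^ k) sums
        (2 ^ ?N * V * r powr (?N - \<mu>) * (1 / (1 - \<theta> powr (?N - \<mu>))))"
      by (intro sums_mult geometric_sums) (use assms in auto)
  qed (auto simp: V_def)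
  finally show ?thesis by (simp add: V_def mult_ac)
qed

lemma nn_integral_norm_powr_cball:
  fixes \<mu> :: real
  assumes "0 \<le> \<mu>" "\<mu> < DIM('a::euclidean_space)"
  obtains C where "0 \<le> C"
    "\<And>r. 0 < r \<Longrightarrow> (\<integral>\<^sup>+y. indicator {y. norm y \<le> r} y * ennreal (norm (y::'a) powr - \<mu>) \<partial>lborel)
       \<le> ennreal (C * r powr (real DIM('a) - \<mu>))"
proof
  let ?s = "real DIM('a) - \<mu>"
  have q: "(1/2) powr ?s < (1::real)"
    using assms powr_less_mono'[of "1/2::real" 0 ?s] by simp
  let ?C = "2 ^ DIM('a) * unit_ball_vol DIM('a) / (1 - (1/2) powr ?s) * (1/2) powr ?s"
  show "0 \<le> ?C" using q by simp
  fix r :: real assume r: "0 < r"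
  have "(\<integral>\<^sup>+y. indicator {y. norm y \<le> r} y * ennreal (norm (y::'a) powr - \<mu>) \<partial>lborel)
      = (\<integral>\<^sup>+y. indicator ({y. norm y \<le> r} - {0}) y * ennreal (norm (y::'a) powr - \<mu>) \<partial>lborel)"
    by (intro nn_integral_cong) (auto simp: indicator_def)
  \<comment> \<open>No shell reaches the origin, so it was removed first; this is free because
    \<open>0 powr\<close> is \<open>0\<close>. The outermost shell is [r/2, r], hence the starting
    radius r/2.\<close>
  also have "\<dots> \<le> ennreal (2 ^ DIM('a) * unit_ball_vol DIM('a) / (1 - (1/2) powr ?s) * (r/2) powr ?s)"
  proof (rule nn_integral_norm_powr_dyadic)
    fix y :: 'a assume "y \<in> {y. norm y \<le> r} - {0}"
    then have y: "0 < norm y" "norm y \<le> r" by auto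
    then obtain k where k: "2 ^ k \<le> r / norm y" "r / norm y < 2 ^ Suc k"
      using ex_dyadic_scale[of "r / norm y"] by auto
    then show "\<exists>k. (1/2) ^ k * (r/2) \<le> norm y \<and> norm y \<le> 2 * ((1/2) ^ k * (r/2))"
      using y by (intro exI[of _ k]) (auto simp: field_simps power_divide)
  qed (use assms q r in auto)
  finally show "(\<integral>\<^sup>+y. indicator {y. norm y \<le> r} y * ennreal (norm (y::'a) powr - \<mu>) \<partial>lborel)
       \<le> ennreal (?C * r powr ?s)"
    using r by (simp add: powr_divide)
qed

lemma nn_integral_norm_powr_outside:
  fixes \<mu> :: real
  assumes "DIM('a::euclidean_space) < \<mu>"
  obtains C where "0 \<le> C"
    "\<And>r. 0 < r \<Longrightarrow> (\<integral>\<^sup>+y. indicator {y. r \<le> norm y} y * ennreal (norm (y::'a) powr - \<mu>) \<partial>lborel)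
       \<le> ennreal (C * r powr (real DIM('a) - \<mu>))"
proof
  let ?s = "real DIM('a) - \<mu>"
  have q: "2 powr ?s < (1::real)"
    using assms powr_less_mono[of ?s 0 "2::real"] by simp
  let ?C = "2 ^ DIM('a) * unit_ball_vol DIM('a) / (1 - 2 powr ?s)"
  show "0 \<le> ?C" using q by simp
  fix r :: real assume r: "0 < r"
  show "(\<integral>\<^sup>+y. indicator {y. r \<le> norm y} y * ennreal (norm (y::'a) powr - \<mu>) \<partial>lborel)
      \<le> ennreal (?C * r powr ?s)"
  proof (rule nn_integral_norm_powr_dyadic)
    fix y :: 'a assume "y \<in> {y. r \<le> norm y}"
    then have y: "r \<le> norm y" by auto
    then obtain k where k: "2 ^ k \<le> norm y / r" "norm y / r < 2 ^ Suc k"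
      using ex_dyadic_scale[of "norm y / r"] r by auto
    then show "\<exists>k. 2 ^ k * r \<le> norm y \<and> norm y \<le> 2 * (2 ^ k * r)"
      using r by (intro exI[of _ k]) (auto simp: field_simps)
  qed (use assms q r in auto)
qed

section \<open>Power kernels and Schur's test\<close>

text \<open>Homogeneity forces the power on the right; the hypotheses are the convergence
  conditions, \<sigma> < N at y = 0 and (N - 1) + \<sigma> > N at infinity, while the singularity at
  y = x has order N - 1 only.\<close>

lemma nn_integral_Riesz_norm_powr:
  fixes \<sigma> :: real
  assumes "1 < \<sigma>" "\<sigma> < DIM('a::euclidean_space)"
  obtains C where "0 < C"
    "\<And>x::'a. x \<noteq> 0 \<Longrightarrow> (\<integral>\<^sup>+y. ennreal (norm (x - y) powr - (real DIM('a) - 1) * norm y powr - \<sigma>) \<partial>lborel)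
       \<le> ennreal (C * norm x powr (1 - \<sigma>))"
proof -
  let ?n = "real DIM('a)"
  obtain C1 where C1: "0 \<le> C1" "\<And>r. 0 < r \<Longrightarrow>
      (\<integral>\<^sup>+y. indicator {y. norm y \<le> r} y * ennreal (norm (y::'a) powr - \<sigma>) \<partial>lborel) \<le> ennreal (C1 * r powr (?n - \<sigma>))"
    using nn_integral_norm_powr_cball[of \<sigma>, where 'a='a] assms by auto
  obtain C2 where C2: "0 \<le> C2" "\<And>r. 0 < r \<Longrightarrow>
      (\<integral>\<^sup>+y. indicator {y. norm y \<le> r} y * ennreal (norm (y::'a) powr - (?n - 1)) \<partial>lborel) \<le> ennreal (C2 * r powr (?n - (?n - 1)))"
    using nn_integral_norm_powr_cball[of "?n - 1", where 'a='a] assms by auto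
  obtain C3 where C3: "0 \<le> C3" "\<And>r. 0 < r \<Longrightarrow>
      (\<integral>\<^sup>+y. indicator {y. r \<le> norm y} y * ennreal (norm (y::'a) powr - (?n - 1 + \<sigma>)) \<partial>lborel)
        \<le> ennreal (C3 * r powr (?n - (?n - 1 + \<sigma>)))"
    using nn_integral_norm_powr_outside[of "?n - 1 + \<sigma>", where 'a='a] assms by auto
  define D where "D = (1/2) powr - (?n - 1) * C1 + (1/2) powr - \<sigma> * C2 * 3 + (1/2) powr - (?n - 1) * C3 * 2 powr (1 - \<sigma>)"
  have "0 \<le> D" using C1 C2 C3 by (simp add: D_def)
  show ?thesis
  \<comment> \<open>\<open>C1\<close>, \<open>C2\<close>, \<open>C3\<close> are only known to be
    nonnegative; the summand \<open>1\<close> makes the constant positive.\<close>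
  proof (rule that[of "D + 1"])
    fix x :: 'a assume "x \<noteq> 0"
    define r where "r = norm x"
    have r: "r > 0" using \<open>x \<noteq> 0\<close> by (simp add: r_def)
    define A where "A y = indicator {y. norm y \<le> r} y * ennreal (norm (y::'a) powr - \<sigma>)" for y
    define B0 where "B0 y = indicator {y. norm y \<le> 3 * r} y * ennreal (norm (y::'a) powr - (?n - 1))" for y
    define B where "B y = B0 (x - y)" for y
    define E where "E y = indicator {y. 2 * r \<le> norm y} y * ennreal (norm (y::'a) powr - (?n - 1 + \<sigma>))" for y
    have [measurable]: "A \<in> borel_measurable borel" "B0 \<in> borel_measurable borel" "E \<in> borel_measurable borel"
      unfolding A_def B0_def E_def by measurable
    have [measurable]: "B \<in> borel_measurable borel" unfolding B_def by measurable
    have le: "ennreal (norm (x - y) powr - (?n - 1) * norm y powr - \<sigma>)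
      \<le> ennreal ((r/2) powr - (?n - 1)) * A y + (ennreal ((r/2) powr - \<sigma>) * B y + ennreal ((1/2) powr - (?n - 1)) * E y)"
      for y
    proof -
      have tri: "r \<le> norm (x - y) + norm y" "norm (x - y) \<le> r + norm y" "norm y \<le> norm (x - y) + r"
        unfolding r_def by norm+
      \<comment> \<open>Near the origin |x - y| is at least r/2. In the middle region |y| exceeds
        r/2 and |x - y| is at most 3 r. In the last one |y| is at least 2 r, so |x - y| is at least
        |y|/2.\<close>
      consider "norm y \<le> r / 2" | "norm y > r / 2" "norm (x - y) \<le> 3 * r" | "norm (x - y) > 3 * r" "norm y > r/2"
        by linarith
      then show ?thesis
      proof cases
        case 1
        have "norm (x - y) powr - (?n - 1) * norm y powr - \<sigma> \<le> (r/2) powr - (?n - 1) * norm y powr - \<sigma>"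
          using 1 tri r assms by (intro mult_right_mono powr_mono2') auto
        then have "ennreal (norm (x - y) powr - (?n - 1) * norm y powr - \<sigma>) \<le> ennreal ((r/2) powr - (?n - 1)) * A y"
          using 1 r by (auto simp: A_def ennreal_mult'[symmetric] intro: ennreal_leI)
        then show ?thesis by (rule order_trans) (simp add: add_increasing2)
      next
        case 2
        have "norm (x - y) powr - (?n - 1) * norm y powr - \<sigma> \<le> norm (x - y) powr - (?n - 1) * (r/2) powr - \<sigma>"
          using 2 tri r assms by (intro mult_left_mono powr_mono2') auto
        then have "ennreal (norm (x - y) powr - (?n - 1) * norm y powr - \<sigma>) \<le> ennreal ((r/2) powr - \<sigma>) * B y"
          using 2 r by (auto simp: B_def B0_def ennreal_mult'[symmetric] mult.commute intro: ennreal_leI)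
        then show ?thesis by (rule order_trans) (simp add: add_increasing add_increasing2)
      next
        case 3
        have y: "2 * r \<le> norm y" using 3 tri by linarith
        have "norm (x - y) powr - (?n - 1) * norm y powr - \<sigma> \<le> (1/2 * norm y) powr - (?n - 1) * norm y powr - \<sigma>"
          using y tri r assms by (intro mult_right_mono powr_mono2') auto
        also have "\<dots> = (1/2) powr - (?n - 1) * norm y powr - (?n - 1 + \<sigma>)"
          using y r unfolding powr_mult[of "1/2" "norm y"] by (simp add: mult.assoc powr_add[symmetric])
        finally have "ennreal (norm (x - y) powr - (?n - 1) * norm y powr - \<sigma>) \<le> ennreal ((1/2) powr - (?n - 1)) * E y"
          using y r by (auto simp: E_def ennreal_mult'[symmetric] intro: ennreal_leI)
        then show ?thesis by (rule order_trans) (simp add: add_increasing)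
      qed
    qed
    have IB: "(\<integral>\<^sup>+y. B y \<partial>lborel) = (\<integral>\<^sup>+y. B0 y \<partial>lborel)"
      using nn_integral_lborel_affine[of B0 "-1" x] by (simp add: B_def)
    have "(\<integral>\<^sup>+y. ennreal (norm (x - y) powr - (?n - 1) * norm y powr - \<sigma>) \<partial>lborel)
      \<le> (\<integral>\<^sup>+y. ennreal ((r/2) powr - (?n - 1)) * A y + (ennreal ((r/2) powr - \<sigma>) * B y + ennreal ((1/2) powr - (?n - 1)) * E y) \<partial>lborel)"
      by (intro nn_integral_mono le)
    also have "\<dots> = ennreal ((r/2) powr - (?n - 1)) * (\<integral>\<^sup>+y. A y \<partial>lborel)
       + (ennreal ((r/2) powr - \<sigma>) * (\<integral>\<^sup>+y. B0 y \<partial>lborel) + ennreal ((1/2) powr - (?n - 1)) * (\<integral>\<^sup>+y. E y \<partial>lborel))"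
      by (simp add: nn_integral_add nn_integral_cmult IB)
    also have "\<dots> \<le> ennreal ((r/2) powr - (?n - 1)) * ennreal (C1 * r powr (?n - \<sigma>))
       + (ennreal ((r/2) powr - \<sigma>) * ennreal (C2 * (3 * r) powr (?n - (?n - 1)))
       + ennreal ((1/2) powr - (?n - 1)) * ennreal (C3 * (2 * r) powr (?n - (?n - 1 + \<sigma>))))"
      using C1(2)[of r] C2(2)[of "3 * r"] C3(2)[of "2 * r"] r
      by (intro add_mono mult_left_mono) (auto simp: A_def B0_def E_def)
    also have "\<dots> = ennreal ((r/2) powr - (?n - 1) * (C1 * r powr (?n - \<sigma>))
       + ((r/2) powr - \<sigma> * (C2 * (3 * r) powr (?n - (?n - 1)))
       + (1/2) powr - (?n - 1) * (C3 * (2 * r) powr (?n - (?n - 1 + \<sigma>)))))"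
      using C1 C2 C3 by (simp add: ennreal_mult'[symmetric] ennreal_plus[symmetric] del: ennreal_plus)
    also have "(r/2) powr - (?n - 1) * (C1 * r powr (?n - \<sigma>)) = (1/2) powr - (?n - 1) * C1 * r powr (1 - \<sigma>)"
    proof -
      have "(r/2) powr - (?n - 1) = (1/2) powr - (?n - 1) * r powr - (?n - 1)"
        using r powr_mult[of "1/2" r "- (?n - 1)"] by simp
      moreover have "r powr - (?n - 1) * r powr (?n - \<sigma>) = r powr (1 - \<sigma>)"
        using r by (simp add: powr_add[symmetric])
      ultimately show ?thesis by simp
    qed
    also have "(r/2) powr - \<sigma> * (C2 * (3 * r) powr (?n - (?n - 1))) = (1/2) powr - \<sigma> * C2 * 3 * r powr (1 - \<sigma>)"
    proof -
      have "(r/2) powr - \<sigma> = (1/2) powr - \<sigma> * r powr - \<sigma>"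
        using r powr_mult[of "1/2" r "- \<sigma>"] by simp
      moreover have "r powr - \<sigma> * r = r powr (1 - \<sigma>)"
        using r powr_add[of r "- \<sigma>" 1] by simp
      ultimately show ?thesis using r by simp
    qed
    also have "(1/2) powr - (?n - 1) * (C3 * (2 * r) powr (?n - (?n - 1 + \<sigma>)))
      = (1/2) powr - (?n - 1) * C3 * 2 powr (1 - \<sigma>) * r powr (1 - \<sigma>)"
      using r by (simp add: powr_mult)
    also have "(1/2) powr - (?n - 1) * C1 * r powr (1 - \<sigma>) + ((1/2) powr - \<sigma> * C2 * 3 * r powr (1 - \<sigma>)
      + (1/2) powr - (?n - 1) * C3 * 2 powr (1 - \<sigma>) * r powr (1 - \<sigma>)) = D * r powr (1 - \<sigma>)"
      by (simp add: D_def algebra_simps)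
    also have "ennreal (D * r powr (1 - \<sigma>)) \<le> ennreal ((D + 1) * r powr (1 - \<sigma>))"
      by (intro ennreal_leI mult_right_mono) auto
    finally show "(\<integral>\<^sup>+y. ennreal (norm (x - y) powr - (?n - 1) * norm y powr - \<sigma>) \<partial>lborel)
       \<le> ennreal ((D + 1) * norm x powr (1 - \<sigma>))" by (simp add: r_def)
  qed (use \<open>0 \<le> D\<close> in auto)
qed

text \<open>Split at |y| = |x|. Inside, the maximum is |x| and \<mu> < N gives convergence at the
  origin; outside it is |y|, and the total exponent 1 + \<mu> > N gives convergence at infinity.
  This handles the term of the increment kernel that comes from the value subtracted at the
  origin.\<close>

lemma nn_integral_norm_powr_max:
  fixes \<mu> :: real
  assumes "real DIM('a::euclidean_space) - 1 < \<mu>" "\<mu> < DIM('a)"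
  obtains C where "0 < C"
    "\<And>x::'a. x \<noteq> 0 \<Longrightarrow> (\<integral>\<^sup>+y. ennreal (norm y powr - \<mu> / max (norm x) (norm y)) \<partial>(lborel :: 'a measure))
       \<le> ennreal (C * norm x powr (real DIM('a) - 1 - \<mu>))"
proof -
  let ?n = "real DIM('a)"
  have n: "?n \<ge> 1" using DIM_positive[where 'a='a] by linarith
  obtain C1 where C1: "0 \<le> C1" "\<And>r. 0 < r \<Longrightarrow>
      (\<integral>\<^sup>+y. indicator {y. norm y \<le> r} y * ennreal (norm (y::'a) powr - \<mu>) \<partial>lborel) \<le> ennreal (C1 * r powr (?n - \<mu>))"
    using nn_integral_norm_powr_cball[of \<mu>, where 'a='a] assms n by auto
  obtain C3 where C3: "0 \<le> C3" "\<And>r. 0 < r \<Longrightarrow>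
      (\<integral>\<^sup>+y. indicator {y. r \<le> norm y} y * ennreal (norm (y::'a) powr - (1 + \<mu>)) \<partial>lborel)
        \<le> ennreal (C3 * r powr (?n - (1 + \<mu>)))"
    using nn_integral_norm_powr_outside[of "1 + \<mu>", where 'a='a] assms by auto
  show ?thesis
  proof (rule that[of "C1 + C3 + 1"])
    fix x :: 'a assume "x \<noteq> 0"
    define r where "r = norm x"
    have r: "r > 0" using \<open>x \<noteq> 0\<close> by (simp add: r_def)
    define A where "A y = indicator {y. norm y \<le> r} y * ennreal (norm (y::'a) powr - \<mu>)" for y
    define E where "E y = indicator {y. r \<le> norm y} y * ennreal (norm (y::'a) powr - (1 + \<mu>))" for y
    have [measurable]: "A \<in> borel_measurable borel" "E \<in> borel_measurable borel"
      unfolding A_def E_def by measurable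
    have le: "ennreal (norm y powr - \<mu> / max r (norm y)) \<le> ennreal (1 / r) * A y + E y" for y
    proof (cases "norm y \<le> r")
      case True
      then have "ennreal (norm y powr - \<mu> / max r (norm y)) = ennreal (1 / r) * A y"
        using r by (simp add: A_def ennreal_mult'[symmetric] max_def)
      then show ?thesis by (simp add: add_increasing2)
    next
      case False
      then have "norm y powr - (1 + \<mu>) = norm y powr - \<mu> / norm y"
        using r powr_add[of "norm y" "- (1 + \<mu>)" 1] by (simp add: field_simps)
      then have "ennreal (norm y powr - \<mu> / max r (norm y)) = E y"
        using False by (simp add: E_def max_def)
      then show ?thesis by (simp add: add_increasing)
    qed
    have "(\<integral>\<^sup>+y. ennreal (norm y powr - \<mu> / max r (norm y)) \<partial>(lborel :: 'a measure))
      \<le> (\<integral>\<^sup>+y. ennreal (1 / r) * A y + E y \<partial>lborel)"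
      by (intro nn_integral_mono le)
    also have "\<dots> = ennreal (1 / r) * (\<integral>\<^sup>+y. A y \<partial>lborel) + (\<integral>\<^sup>+y. E y \<partial>lborel)"
      by (simp add: nn_integral_add nn_integral_cmult)
    also have "\<dots> \<le> ennreal (1 / r) * ennreal (C1 * r powr (?n - \<mu>)) + ennreal (C3 * r powr (?n - (1 + \<mu>)))"
      using C1(2)[of r] C3(2)[of r] r by (intro add_mono mult_left_mono) (auto simp: A_def E_def)
    also have "\<dots> = ennreal (1 / r * (C1 * r powr (?n - \<mu>)) + C3 * r powr (?n - (1 + \<mu>)))"
      using C1 C3 r by (simp add: ennreal_mult'[symmetric] ennreal_plus[symmetric] del: ennreal_plus)
    also have "1 / r * (C1 * r powr (?n - \<mu>)) = C1 * r powr (?n - 1 - \<mu>)"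
      using r powr_add[of r "?n - 1 - \<mu>" 1] by simp
    also have "C1 * r powr (?n - 1 - \<mu>) + C3 * r powr (?n - (1 + \<mu>)) = (C1 + C3) * r powr (?n - 1 - \<mu>)"
      by (simp add: algebra_simps)
    also have "ennreal \<dots> \<le> ennreal ((C1 + C3 + 1) * r powr (?n - 1 - \<mu>))"
      by (intro ennreal_leI mult_right_mono) auto
    finally show "(\<integral>\<^sup>+y. ennreal (norm y powr - \<mu> / max (norm x) (norm y)) \<partial>(lborel :: 'a measure))
       \<le> ennreal ((C1 + C3 + 1) * norm x powr (?n - 1 - \<mu>))" by (simp add: r_def)
  qed (use C1 C3 in auto)
qed

text \<open>A Jensen inequality with the factor 2^n given away. Integrating s \<le> c + s^n / c^(n -
  1) against \<open>w\<close> gives F \<le> c m + P / c^(n - 1) for every c > 0, and a suitable c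
  lets half of F be absorbed.\<close>

lemma power_nn_integral_le:
  assumes [measurable]: "w \<in> borel_measurable M" "t \<in> borel_measurable M"
    and w: "(\<integral>\<^sup>+x. w x \<partial>M) \<le> ennreal m" and "0 < m" and "1 \<le> n"
  shows "(\<integral>\<^sup>+x. w x * t x \<partial>M) ^ n \<le> ennreal (2 ^ n * m ^ (n - 1)) * (\<integral>\<^sup>+x. w x * t x ^ n \<partial>M)"
proof -
  let ?F = "\<integral>\<^sup>+x. w x * t x \<partial>M" and ?P = "\<integral>\<^sup>+x. w x * t x ^ n \<partial>M"
  obtain k where n: "n = Suc k" using \<open>1 \<le> n\<close> by (cases n) auto
  \<comment> \<open>If s exceeds c, then (s/c)^k is at least 1.\<close>
  have pt: "s \<le> ennreal c + ennreal (1 / c ^ k) * s ^ n" if "0 < c" for s c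
  proof (cases s)
    case (real r)
    have "r \<le> c + 1 / c ^ k * r ^ n"
    proof (cases "r \<le> c")
      case True
      then show ?thesis using real that by (intro order_trans[OF True]) simp
    next
      case False
      then have "r * c ^ k \<le> r * r ^ k" using real that by (intro mult_left_mono power_mono) auto
      then have "r \<le> 1 / c ^ k * r ^ n" using that by (simp add: n field_simps)
      then show ?thesis using that by linarith
    qed
    then show ?thesis using real that
      by (simp add: ennreal_power ennreal_mult'[symmetric] ennreal_plus[symmetric] ennreal_leI del: ennreal_plus)
  next
    case top
    then show ?thesis using that by (simp add: n ennreal_mult_top ennreal_top_mult power_Suc_0 ennreal_top_mult top_power_ennreal)
  qed
  have F: "?F \<le> ennreal (c * m) + ennreal (1 / c ^ k) * ?P" if "0 < c" for c
  proof -
    have "?F \<le> (\<integral>\<^sup>+x. ennreal c * w x + ennreal (1 / c ^ k) * (w x * t x ^ n) \<partial>M)"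
    proof (rule nn_integral_mono)
      fix x
      have "w x * t x \<le> w x * (ennreal c + ennreal (1 / c ^ k) * t x ^ n)"
        by (intro mult_left_mono pt that) auto
      then show "w x * t x \<le> ennreal c * w x + ennreal (1 / c ^ k) * (w x * t x ^ n)"
        by (simp add: algebra_simps)
    qed
    also have "\<dots> = ennreal c * (\<integral>\<^sup>+x. w x \<partial>M) + ennreal (1 / c ^ k) * ?P"
      by (simp add: nn_integral_add nn_integral_cmult)
    also have "\<dots> \<le> ennreal c * ennreal m + ennreal (1 / c ^ k) * ?P"
      by (intro add_mono mult_left_mono w) auto
    finally show ?thesis using that by (simp add: ennreal_mult')
  qed
  show ?thesis
  proof (cases ?P)
    case top
    then show ?thesis using \<open>0 < m\<close> by (simp add: ennreal_mult_top)
  next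
    case (real p)
    \<comment> \<open>The choice c = 1 shows that F is finite; only then may the later choice of c
      depend on F.\<close>
    have "?F < top" using F[of 1] real by (auto simp: top_unique less_top[symmetric])
    then obtain f where f: "?F = ennreal f" "0 \<le> f" by (cases ?F) auto
    have le: "f \<le> c * m + p / c ^ k" if "0 < c" for c
      using F[OF that] f real that \<open>0 < m\<close>
      by (simp add: ennreal_mult'[symmetric] ennreal_plus[symmetric] del: ennreal_plus)
    have "f ^ n \<le> 2 ^ n * m ^ k * p"
    proof (cases "f = 0")
      case True then show ?thesis using real \<open>0 < m\<close> by (simp add: n)
    next
      case False
      then have "0 < f" using f by simp
      \<comment> \<open>With c = f/(2m) the first term is f/2 and can be subtracted.\<close>
      then have "f \<le> f / 2 + p / (f / (2 * m)) ^ k" using le[of "f / (2 * m)"] \<open>0 < m\<close> by simp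
      then have "f / 2 \<le> p / (f / (2 * m)) ^ k" by linarith
      then show ?thesis using \<open>0 < f\<close> by (simp add: n field_simps power_divide power_mult_distrib)
    qed
    then show ?thesis using real f \<open>0 < m\<close>
      by (simp add: n ennreal_power ennreal_mult'[symmetric] ennreal_leI)
  qed
qed

text \<open>The integrand is factored as (k |y|^-\<sigma>) (f |y|^\<sigma>), and the power
  inequality above is applied with mass A |x|^-\<sigma>. This leaves the factor |x|^(a - \<sigma> (n
  - 1)), and the relation for \<open>a\<close> makes it |x|^-\<tau>, the weight that
  \<open>B\<close> integrates in x after Fubini. The condition \<open>f 0 = 0\<close> keeps the
  factorization valid at y = 0, where every \<open>powr\<close> is \<open>0\<close>.\<close>

lemma nn_integral_schur_powr:
  fixes k :: "'a::euclidean_space \<Rightarrow> 'a \<Rightarrow> real" and f :: "'a \<Rightarrow> real"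
  assumes [measurable]: "(\<lambda>(x, y). k x y) \<in> borel_measurable (borel \<Otimes>\<^sub>M borel)" "f \<in> borel_measurable borel"
    and k: "\<And>x y. 0 \<le> k x y" and f: "\<And>y. 0 \<le> f y" "f 0 = 0"
    and "0 < A" "0 < B" "1 \<le> n"
    and A: "\<And>x. x \<noteq> 0 \<Longrightarrow> (\<integral>\<^sup>+y. ennreal (k x y * norm y powr - \<sigma>) \<partial>lborel) \<le> ennreal (A * norm x powr - \<sigma>)"
    and B: "\<And>y. y \<noteq> 0 \<Longrightarrow> (\<integral>\<^sup>+x. ennreal (k x y * norm x powr - \<tau>) \<partial>lborel) \<le> ennreal (B * norm y powr - \<tau>)"
    and a: "a = \<sigma> * (real n - 1) - \<tau>"
  shows "(\<integral>\<^sup>+x. (\<integral>\<^sup>+y. ennreal (k x y * f y) \<partial>lborel) ^ n * ennreal (norm x powr a) \<partial>lborel)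
    \<le> ennreal (2 ^ n * A ^ (n - 1) * B) * (\<integral>\<^sup>+y. ennreal (f y ^ n * norm y powr a) \<partial>lborel)"
proof -
  have [measurable]: "(\<lambda>y. k x y) \<in> borel_measurable borel" for x
    using measurable_compose[OF measurable_Pair1'[of x borel borel] assms(1)] by simp
  have [measurable]: "(\<lambda>x. k x y) \<in> borel_measurable borel" for y
    using measurable_compose[OF measurable_Pair2'[of y borel borel] assms(1)] by simp
  define G where "G x y = ennreal (k x y * norm x powr - \<tau>) * ennreal (f y ^ n * norm y powr (\<sigma> * (real n - 1)))" for x y
  have G[measurable]: "(\<lambda>(x, y). G x y) \<in> borel_measurable (lborel \<Otimes>\<^sub>M lborel)"
    unfolding G_def by measurable
  have pt: "(\<integral>\<^sup>+y. ennreal (k x y * f y) \<partial>lborel) ^ n * ennreal (norm x powr a)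
      \<le> ennreal (2 ^ n * A ^ (n - 1)) * (\<integral>\<^sup>+y. G x y \<partial>lborel)" for x
  proof (cases "x = 0")
    case False
    let ?w = "\<lambda>y. ennreal (k x y * norm y powr - \<sigma>)" and ?t = "\<lambda>y. ennreal (f y * norm y powr \<sigma>)"
    have 1: "?w y * ?t y = ennreal (k x y * f y)" for y
      using f(2) by (cases "y = 0") (simp_all add: ennreal_mult'[symmetric] k f powr_minus)
    have 2: "?w y * ?t y ^ n = ennreal (k x y) * ennreal (f y ^ n * norm y powr (\<sigma> * (real n - 1)))" for y
    proof (cases "y = 0")
      case True then show ?thesis using f(2) \<open>1 \<le> n\<close> by (simp add: zero_power)
    next
      case False
      then have "norm y powr - \<sigma> * (norm y powr \<sigma>) ^ n = norm y powr (\<sigma> * (real n - 1))"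
        by (simp add: powr_power powr_add[symmetric] algebra_simps)
      then have "k x y * norm y powr - \<sigma> * (f y * norm y powr \<sigma>) ^ n = k x y * (f y ^ n * norm y powr (\<sigma> * (real n - 1)))"
        by (simp add: power_mult_distrib mult_ac)
      then show ?thesis by (simp add: ennreal_power k f ennreal_mult'[symmetric])
    qed
    have "(\<integral>\<^sup>+y. ennreal (k x y * f y) \<partial>lborel) ^ n * ennreal (norm x powr a)
      \<le> ennreal (2 ^ n * (A * norm x powr - \<sigma>) ^ (n - 1)) * (\<integral>\<^sup>+y. ?w y * ?t y ^ n \<partial>lborel) * ennreal (norm x powr a)"
      using power_nn_integral_le[of ?w lborel ?t "A * norm x powr - \<sigma>" n] A[OF False] False \<open>0 < A\<close> \<open>1 \<le> n\<close>
      by (intro mult_right_mono) (simp_all add: 1)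
    also have "\<dots> = ennreal (2 ^ n * (A * norm x powr - \<sigma>) ^ (n - 1) * norm x powr a)
        * (\<integral>\<^sup>+y. ?w y * ?t y ^ n \<partial>lborel)"
      using \<open>0 < A\<close> by (simp add: ennreal_mult' mult_ac)
    also have "2 ^ n * (A * norm x powr - \<sigma>) ^ (n - 1) * norm x powr a = 2 ^ n * A ^ (n - 1) * norm x powr - \<tau>"
    proof -
      have "(norm x powr - \<sigma>) ^ (n - 1) * norm x powr a = norm x powr - \<tau>"
        using False \<open>1 \<le> n\<close> by (simp add: powr_power powr_add[symmetric] a of_nat_diff algebra_simps)
      then show ?thesis by (simp add: power_mult_distrib)
    qed
    also have "ennreal (2 ^ n * A ^ (n - 1) * norm x powr - \<tau>) * (\<integral>\<^sup>+y. ?w y * ?t y ^ n \<partial>lborel)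
      = ennreal (2 ^ n * A ^ (n - 1)) * (ennreal (norm x powr - \<tau>) * (\<integral>\<^sup>+y. ?w y * ?t y ^ n \<partial>lborel))"
      using \<open>0 < A\<close> by (simp add: ennreal_mult' mult_ac)
    also have "ennreal (norm x powr - \<tau>) * (\<integral>\<^sup>+y. ?w y * ?t y ^ n \<partial>lborel) = (\<integral>\<^sup>+y. G x y \<partial>lborel)"
      unfolding 2 G_def by (subst nn_integral_cmult[symmetric]) (auto simp: ennreal_mult' k mult_ac)
    finally show ?thesis .
  qed simp
  have "(\<integral>\<^sup>+x. (\<integral>\<^sup>+y. ennreal (k x y * f y) \<partial>lborel) ^ n * ennreal (norm x powr a) \<partial>lborel)
     \<le> (\<integral>\<^sup>+x. ennreal (2 ^ n * A ^ (n - 1)) * (\<integral>\<^sup>+y. G x y \<partial>lborel) \<partial>lborel)"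
    by (intro nn_integral_mono pt)
  also have "\<dots> = ennreal (2 ^ n * A ^ (n - 1)) * (\<integral>\<^sup>+x. (\<integral>\<^sup>+y. G x y \<partial>lborel) \<partial>lborel)"
    by (intro nn_integral_cmult) measurable
  also have "(\<integral>\<^sup>+x. (\<integral>\<^sup>+y. G x y \<partial>lborel) \<partial>lborel) = (\<integral>\<^sup>+y. (\<integral>\<^sup>+x. G x y \<partial>lborel) \<partial>lborel)"
    using lborel_pair.Fubini'[OF G] by simp
  also have "\<dots> \<le> (\<integral>\<^sup>+y. ennreal B * ennreal (f y ^ n * norm y powr a) \<partial>lborel)"
  proof (rule nn_integral_mono)
    fix y :: 'a
    show "(\<integral>\<^sup>+x. G x y \<partial>lborel) \<le> ennreal B * ennreal (f y ^ n * norm y powr a)"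
    proof (cases "y = 0")
      case True
      then show ?thesis using f(2) \<open>1 \<le> n\<close> by (simp add: G_def zero_power)
    next
      case False
      have "(\<integral>\<^sup>+x. G x y \<partial>lborel)
        = (\<integral>\<^sup>+x. ennreal (k x y * norm x powr - \<tau>) \<partial>lborel) * ennreal (f y ^ n * norm y powr (\<sigma> * (real n - 1)))"
        unfolding G_def by (intro nn_integral_multc) measurable
      also have "\<dots> \<le> ennreal (B * norm y powr - \<tau>) * ennreal (f y ^ n * norm y powr (\<sigma> * (real n - 1)))"
        by (intro mult_right_mono B False) auto
      also have "\<dots> = ennreal (B * (f y ^ n * (norm y powr - \<tau> * norm y powr (\<sigma> * (real n - 1)))))"
        using \<open>0 < B\<close> f by (simp add: ennreal_mult'[symmetric] mult_ac)
      also have "norm y powr - \<tau> * norm y powr (\<sigma> * (real n - 1)) = norm y powr a"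
        using False by (simp add: powr_add[symmetric] a)
      finally show ?thesis using \<open>0 < B\<close> by (simp add: ennreal_mult')
    qed
  qed
  also have "\<dots> = ennreal B * (\<integral>\<^sup>+y. ennreal (f y ^ n * norm y powr a) \<partial>lborel)"
    by (intro nn_integral_cmult) measurable
  finally show ?thesis
    using \<open>0 < A\<close> \<open>0 < B\<close> by (simp add: ennreal_mult' mult_left_mono mult.assoc)
qed

section \<open>Schur exponents for the two kernels\<close>

lemma inverse_max_le_powr:
  fixes r s \<theta> :: real
  assumes "0 < r" "0 < s" "0 \<le> \<theta>" "\<theta> \<le> 1"
  shows "1 / max r s \<le> r powr - \<theta> * s powr - (1 - \<theta>)"
proof -
  let ?m = "max r s"
  have "1 / ?m = ?m powr - \<theta> * ?m powr - (1 - \<theta>)"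
    using assms by (simp only: powr_add[symmetric]) (simp add: powr_minus_divide)
  \<comment> \<open>Powers with nonpositive exponent decrease, so the maximum may be replaced by
    \<open>r\<close> in one factor and by \<open>s\<close> in the other.\<close>
  also have "\<dots> \<le> r powr - \<theta> * s powr - (1 - \<theta>)"
    using assms by (intro mult_mono powr_mono2') auto
  finally show ?thesis .
qed

lemma nn_integral_weighted_fractional_pos:
  fixes a :: real
  assumes N: "2 \<le> DIM('a::euclidean_space)" and a: "0 < a" "a < 1"
  obtains C where "0 < C"
    "\<And>f :: 'a \<Rightarrow> real. f \<in> borel_measurable borel \<Longrightarrow> (\<And>y. 0 \<le> f y) \<Longrightarrow> f 0 = 0 \<Longrightarrow>
      (\<integral>\<^sup>+x. (\<integral>\<^sup>+y. ennreal (norm x powr - 1 * norm (x - y) powr - (real DIM('a) - 1) * f y) \<partial>lborel) ^ DIM('a)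
          * ennreal (norm x powr a) \<partial>lborel)
        \<le> ennreal C * (\<integral>\<^sup>+y. ennreal (f y ^ DIM('a) * norm y powr a) \<partial>lborel)"
proof -
  let ?n = "real DIM('a)"
  have n: "2 \<le> ?n" using N by linarith
  \<comment> \<open>\<open>\<sigma>\<close> sits just above 1 and \<open>\<tau>\<close> just below N
    - 1; each deviation contributes a/2 to \<open>\<sigma> * (N - 1) - \<tau>\<close>, where the
    main terms cancel.\<close>
  define \<sigma> \<tau> where "\<sigma> = 1 + a / (2 * (?n - 1))" and "\<tau> = ?n - 1 - a / 2"
  have "a / (2 * (?n - 1)) \<le> a / 2" using n a by (intro divide_left_mono) auto
  moreover have "0 < a / (2 * (?n - 1))" using n a by simp
  ultimately have \<sigma>: "1 < \<sigma>" "\<sigma> < ?n" using n a unfolding \<sigma>_def by linarith+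
  have \<tau>: "1 < 1 + \<tau>" "1 + \<tau> < ?n" using n a by (auto simp: \<tau>_def)
  have eq: "a = \<sigma> * (?n - 1) - \<tau>" using n by (simp add: \<sigma>_def \<tau>_def field_simps)
  obtain A where A: "0 < A" "\<And>x::'a. x \<noteq> 0 \<Longrightarrow>
      (\<integral>\<^sup>+y. ennreal (norm (x - y) powr - (?n - 1) * norm y powr - \<sigma>) \<partial>lborel) \<le> ennreal (A * norm x powr (1 - \<sigma>))"
    using nn_integral_Riesz_norm_powr[OF \<sigma>] by blast
  \<comment> \<open>In the x integration the factor |x|^-1 of the kernel joins the weight, hence the
    exponent 1 + \<tau>.\<close>
  obtain B where B: "0 < B" "\<And>x::'a. x \<noteq> 0 \<Longrightarrow>
      (\<integral>\<^sup>+y. ennreal (norm (x - y) powr - (?n - 1) * norm y powr - (1 + \<tau>)) \<partial>lborel) \<le> ennreal (B * norm x powr (1 - (1 + \<tau>)))"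
    using nn_integral_Riesz_norm_powr[OF \<tau>] by blast
  let ?k = "\<lambda>x y::'a. norm x powr - 1 * norm (x - y) powr - (?n - 1)"
  show ?thesis
  proof (rule that[of "2 ^ DIM('a) * A ^ (DIM('a) - 1) * B"])
    fix f :: "'a \<Rightarrow> real" assume f: "f \<in> borel_measurable borel" "\<And>y. 0 \<le> f y" "f 0 = 0"
    show "(\<integral>\<^sup>+x. (\<integral>\<^sup>+y. ennreal (?k x y * f y) \<partial>lborel) ^ DIM('a) * ennreal (norm x powr a) \<partial>lborel)
        \<le> ennreal (2 ^ DIM('a) * A ^ (DIM('a) - 1) * B) * (\<integral>\<^sup>+y. ennreal (f y ^ DIM('a) * norm y powr a) \<partial>lborel)"
    proof (rule nn_integral_schur_powr[OF _ f(1) _ f(2,3) A(1) B(1) _ _ _ eq])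
      show "(\<lambda>(x, y). ?k x y) \<in> borel_measurable (borel \<Otimes>\<^sub>M borel)" by measurable
    next
      fix x :: 'a assume x: "x \<noteq> 0"
      have "(\<integral>\<^sup>+y. ennreal (?k x y * norm y powr - \<sigma>) \<partial>lborel)
        = ennreal (norm x powr - 1) * (\<integral>\<^sup>+y. ennreal (norm (x - y) powr - (?n - 1) * norm y powr - \<sigma>) \<partial>lborel)"
        by (subst nn_integral_cmult[symmetric]) (measurable, simp only: ennreal_mult'[symmetric] powr_ge_zero mult.assoc)
      also have "\<dots> \<le> ennreal (norm x powr - 1) * ennreal (A * norm x powr (1 - \<sigma>))"
        by (intro mult_left_mono A x) auto
      also have "\<dots> = ennreal (A * (norm x powr - 1 * norm x powr (1 - \<sigma>)))"
        by (simp add: ennreal_mult'[symmetric] mult_ac)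
      finally show "(\<integral>\<^sup>+y. ennreal (?k x y * norm y powr - \<sigma>) \<partial>lborel) \<le> ennreal (A * norm x powr - \<sigma>)"
        using x by (simp only: powr_add[symmetric]) simp
    next
      fix y :: 'a assume y: "y \<noteq> 0"
      have "(\<integral>\<^sup>+x. ennreal (?k x y * norm x powr - \<tau>) \<partial>lborel)
        = (\<integral>\<^sup>+x. ennreal (norm (y - x) powr - (?n - 1) * norm x powr - (1 + \<tau>)) \<partial>lborel)"
      proof (intro nn_integral_cong arg_cong[of _ _ ennreal])
        fix x :: 'a
        show "?k x y * norm x powr - \<tau> = norm (y - x) powr - (?n - 1) * norm x powr - (1 + \<tau>)"
          using powr_add[of "norm x" "-1" "-\<tau>"] by (cases "x = 0") (simp_all add: norm_minus_commute)
      qed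
      also have "\<dots> \<le> ennreal (B * norm y powr (1 - (1 + \<tau>)))" by (intro B y)
      finally show "(\<integral>\<^sup>+x. ennreal (?k x y * norm x powr - \<tau>) \<partial>lborel) \<le> ennreal (B * norm y powr - \<tau>)" by simp
    qed (use N in auto)
  qed (use A B in auto)
qed

lemma nn_integral_weighted_fractional_neg:
  fixes a :: real
  assumes N: "2 \<le> DIM('a::euclidean_space)" and a: "- real DIM('a) < a" "a < 0"
  obtains C where "0 < C"
    "\<And>f :: 'a \<Rightarrow> real. f \<in> borel_measurable borel \<Longrightarrow> (\<And>y. 0 \<le> f y) \<Longrightarrow> f 0 = 0 \<Longrightarrow>
      (\<integral>\<^sup>+x. (\<integral>\<^sup>+y. ennreal ((norm (x - y) powr - (real DIM('a) - 1) + norm y powr - (real DIM('a) - 1))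
            / max (norm x) (norm y) * f y) \<partial>lborel) ^ DIM('a) * ennreal (norm x powr a) \<partial>lborel)
        \<le> ennreal C * (\<integral>\<^sup>+y. ennreal (f y ^ DIM('a) * norm y powr a) \<partial>lborel)"
proof -
  let ?n = "real DIM('a)"
  have n: "2 \<le> ?n" using N by linarith
  \<comment> \<open>The common value s = \<sigma> (N - 1) = \<tau> + a must lie in (0, N - 1) for
    \<sigma> and in (N - 1 + a, N + a) for \<tau>. These intervals meet because -N < a < 0, and s is
    the midpoint of their intersection.\<close>
  define s where "s = (max 0 (?n - 1 + a) + min (?n - 1) (?n + a)) / 2"
  have s: "0 < s" "?n - 1 + a < s" "s < ?n - 1" "s < ?n + a"
    using n a by (auto simp: s_def max_def min_def)
  define \<sigma> \<tau> where "\<sigma> = s / (?n - 1)" and "\<tau> = s - a"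
  have \<sigma>: "0 < \<sigma>" "\<sigma> < 1" using n s by (auto simp: \<sigma>_def)
  have \<tau>: "?n - 1 < \<tau>" "\<tau> < ?n" using s by (auto simp: \<tau>_def)
  have eq: "a = \<sigma> * (?n - 1) - \<tau>" using n by (simp add: \<sigma>_def \<tau>_def)
  obtain A1 where A1: "0 < A1" "\<And>x::'a. x \<noteq> 0 \<Longrightarrow>
      (\<integral>\<^sup>+y. ennreal (norm (x - y) powr - (?n - 1) * norm y powr - (1 + \<sigma> / 2)) \<partial>lborel) \<le> ennreal (A1 * norm x powr (1 - (1 + \<sigma> / 2)))"
    using nn_integral_Riesz_norm_powr[of "1 + \<sigma> / 2", where 'a='a] \<sigma> n by auto
  obtain A2 where A2: "0 < A2" "\<And>x::'a. x \<noteq> 0 \<Longrightarrow>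
      (\<integral>\<^sup>+y. ennreal (norm y powr - (?n - 1 + \<sigma>) / max (norm x) (norm y)) \<partial>(lborel::'a measure)) \<le> ennreal (A2 * norm x powr (?n - 1 - (?n - 1 + \<sigma>)))"
    using nn_integral_norm_powr_max[of "?n - 1 + \<sigma>", where 'a='a] \<sigma> by auto
  obtain B1 where B1: "0 < B1" "\<And>x::'a. x \<noteq> 0 \<Longrightarrow>
      (\<integral>\<^sup>+y. ennreal (norm (x - y) powr - (?n - 1) * norm y powr - \<tau>) \<partial>lborel) \<le> ennreal (B1 * norm x powr (1 - \<tau>))"
    using nn_integral_Riesz_norm_powr[of \<tau>, where 'a='a] \<tau> n by auto
  obtain B2 where B2: "0 < B2" "\<And>x::'a. x \<noteq> 0 \<Longrightarrow>
      (\<integral>\<^sup>+y. ennreal (norm y powr - \<tau> / max (norm x) (norm y)) \<partial>(lborel::'a measure)) \<le> ennreal (B2 * norm x powr (?n - 1 - \<tau>))"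
    using nn_integral_norm_powr_max[of \<tau>, where 'a='a] \<tau> by auto
  let ?k = "\<lambda>x y::'a. (norm (x - y) powr - (?n - 1) + norm y powr - (?n - 1)) / max (norm x) (norm y)"
  show ?thesis
  proof (rule that[of "2 ^ DIM('a) * (A1 + A2) ^ (DIM('a) - 1) * (B1 + B2)"])
    fix f :: "'a \<Rightarrow> real" assume f: "f \<in> borel_measurable borel" "\<And>y. 0 \<le> f y" "f 0 = 0"
    show "(\<integral>\<^sup>+x. (\<integral>\<^sup>+y. ennreal (?k x y * f y) \<partial>lborel) ^ DIM('a) * ennreal (norm x powr a) \<partial>lborel)
        \<le> ennreal (2 ^ DIM('a) * (A1 + A2) ^ (DIM('a) - 1) * (B1 + B2)) * (\<integral>\<^sup>+y. ennreal (f y ^ DIM('a) * norm y powr a) \<partial>lborel)"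
    proof (rule nn_integral_schur_powr[OF _ f(1) _ f(2,3) _ _ _ _ _ eq])
      show "(\<lambda>(x, y). ?k x y) \<in> borel_measurable (borel \<Otimes>\<^sub>M borel)" by measurable
    next
      fix x y :: 'a show "0 \<le> ?k x y" by (simp add: max_def)
    next
      fix x :: 'a assume x: "x \<noteq> 0"
      let ?f1 = "\<lambda>y::'a. ennreal (norm (x - y) powr - (?n - 1) * norm y powr - (1 + \<sigma> / 2))"
      let ?f2 = "\<lambda>y::'a. ennreal (norm y powr - (?n - 1 + \<sigma>) / max (norm x) (norm y))"
      have "(\<integral>\<^sup>+y. ennreal (?k x y * norm y powr - \<sigma>) \<partial>lborel)
        \<le> (\<integral>\<^sup>+y. ennreal (norm x powr - (\<sigma> / 2)) * ?f1 y + ?f2 y \<partial>lborel)"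
      proof (rule nn_integral_mono)
        fix y :: 'a
        show "ennreal (?k x y * norm y powr - \<sigma>) \<le> ennreal (norm x powr - (\<sigma> / 2)) * ?f1 y + ?f2 y"
        proof (cases "y = 0")
          case False
          have y\<sigma>: "norm y powr - \<sigma> * norm y powr - (1 - \<sigma> / 2) = norm y powr - (1 + \<sigma> / 2)"
            by (simp only: powr_add[symmetric]) (rule arg_cong[of _ _ "(powr) (norm y)"], simp)
          \<comment> \<open>Sharing out 1/max with \<theta> = \<sigma>/2 gives |y| the total
            exponent 1 + \<sigma>/2, inside the window (1, N) of the Riesz bound.\<close>
          have "norm (x - y) powr - (?n - 1) * (norm y powr - \<sigma> * (1 / max (norm x) (norm y)))
            \<le> norm (x - y) powr - (?n - 1) * (norm y powr - \<sigma> * (norm x powr - (\<sigma> / 2) * norm y powr - (1 - \<sigma> / 2)))"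
            using x False \<sigma> by (intro mult_left_mono inverse_max_le_powr) auto
          also have "norm y powr - \<sigma> * (norm x powr - (\<sigma> / 2) * norm y powr - (1 - \<sigma> / 2))
            = norm x powr - (\<sigma> / 2) * norm y powr - (1 + \<sigma> / 2)"
            using y\<sigma> by (metis mult.left_commute)
          finally have "norm (x - y) powr - (?n - 1) * norm y powr - \<sigma> * (1 / max (norm x) (norm y))
            \<le> norm x powr - (\<sigma> / 2) * (norm (x - y) powr - (?n - 1) * norm y powr - (1 + \<sigma> / 2))"
            by (simp add: mult_ac)
          moreover have "norm y powr - (?n - 1) * norm y powr - \<sigma> = norm y powr - (?n - 1 + \<sigma>)"
            using False by (simp add: powr_add[symmetric])
          ultimately have "?k x y * norm y powr - \<sigma> \<le> norm x powr - (\<sigma> / 2) * (norm (x - y) powr - (?n - 1) * norm y powr - (1 + \<sigma> / 2))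
              + norm y powr - (?n - 1 + \<sigma>) / max (norm x) (norm y)"
            by (simp add: add_divide_distrib distrib_right)
          then have "ennreal (?k x y * norm y powr - \<sigma>) \<le> ennreal (norm x powr - (\<sigma> / 2) * (norm (x - y) powr - (?n - 1) * norm y powr - (1 + \<sigma> / 2))
              + norm y powr - (?n - 1 + \<sigma>) / max (norm x) (norm y))"
            by (rule ennreal_leI)
          also have "\<dots> = ennreal (norm x powr - (\<sigma> / 2)) * ?f1 y + ?f2 y"
            by (subst ennreal_plus) (auto simp: ennreal_mult' le_max_iff_disj)
          finally show ?thesis .
        qed simp
      qed
      also have "\<dots> = ennreal (norm x powr - (\<sigma> / 2)) * (\<integral>\<^sup>+y. ?f1 y \<partial>lborel) + (\<integral>\<^sup>+y. ?f2 y \<partial>lborel)"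
        by (simp add: nn_integral_add nn_integral_cmult)
      also have "\<dots> \<le> ennreal (norm x powr - (\<sigma> / 2)) * ennreal (A1 * norm x powr (1 - (1 + \<sigma> / 2))) + ennreal (A2 * norm x powr (?n - 1 - (?n - 1 + \<sigma>)))"
        by (intro add_mono mult_left_mono A1 A2 x) auto
      also have "\<dots> = ennreal (A1 * (norm x powr - (\<sigma> / 2) * norm x powr - (\<sigma> / 2)) + A2 * norm x powr - \<sigma>)"
        using A1(1) A2(1) by (subst ennreal_plus) (auto simp: ennreal_mult'[symmetric] mult_ac)
      also have "A1 * (norm x powr - (\<sigma> / 2) * norm x powr - (\<sigma> / 2)) + A2 * norm x powr - \<sigma> = (A1 + A2) * norm x powr - \<sigma>"
        using x by (simp add: powr_add[symmetric] distrib_right)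
      finally show "(\<integral>\<^sup>+y. ennreal (?k x y * norm y powr - \<sigma>) \<partial>lborel) \<le> ennreal ((A1 + A2) * norm x powr - \<sigma>)" .
    next
      fix y :: 'a assume y: "y \<noteq> 0"
      let ?f1 = "\<lambda>x::'a. ennreal (norm (y - x) powr - (?n - 1) * norm x powr - \<tau>)"
      let ?f2 = "\<lambda>x::'a. ennreal (norm x powr - \<tau> / max (norm y) (norm x))"
      have "(\<integral>\<^sup>+x. ennreal (?k x y * norm x powr - \<tau>) \<partial>lborel)
        \<le> (\<integral>\<^sup>+x. ennreal (1 / norm y) * ?f1 x + ennreal (norm y powr - (?n - 1)) * ?f2 x \<partial>lborel)"
      proof (rule nn_integral_mono)
        fix x :: 'a
        \<comment> \<open>Here 1/max is bounded by 1/|y|, a constant for the x integration; the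
          remaining exponent \<tau> > N - 1 \<ge> 1 suits the Riesz bound by itself.\<close>
        have "norm (x - y) powr - (?n - 1) * norm x powr - \<tau> * (1 / max (norm x) (norm y))
          \<le> norm (x - y) powr - (?n - 1) * norm x powr - \<tau> * (1 / norm y)"
          using y by (intro mult_left_mono divide_left_mono) (auto simp: less_max_iff_disj)
        then have "?k x y * norm x powr - \<tau> \<le> 1 / norm y * (norm (y - x) powr - (?n - 1) * norm x powr - \<tau>)
            + norm y powr - (?n - 1) * (norm x powr - \<tau> / max (norm y) (norm x))"
          by (simp add: add_divide_distrib distrib_right norm_minus_commute max.commute)
        then have "ennreal (?k x y * norm x powr - \<tau>) \<le> ennreal (1 / norm y * (norm (y - x) powr - (?n - 1) * norm x powr - \<tau>)
            + norm y powr - (?n - 1) * (norm x powr - \<tau> / max (norm y) (norm x)))"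
          by (rule ennreal_leI)
        also have "\<dots> = ennreal (1 / norm y) * ?f1 x + ennreal (norm y powr - (?n - 1)) * ?f2 x"
          by (subst ennreal_plus) (auto simp: ennreal_mult'[symmetric] le_max_iff_disj)
        finally show "ennreal (?k x y * norm x powr - \<tau>) \<le> ennreal (1 / norm y) * ?f1 x + ennreal (norm y powr - (?n - 1)) * ?f2 x" .
      qed
      also have "\<dots> = ennreal (1 / norm y) * (\<integral>\<^sup>+x. ?f1 x \<partial>lborel) + ennreal (norm y powr - (?n - 1)) * (\<integral>\<^sup>+x. ?f2 x \<partial>lborel)"
        by (simp add: nn_integral_add nn_integral_cmult)
      also have "\<dots> \<le> ennreal (1 / norm y) * ennreal (B1 * norm y powr (1 - \<tau>)) + ennreal (norm y powr - (?n - 1)) * ennreal (B2 * norm y powr (?n - 1 - \<tau>))"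
        by (intro add_mono mult_left_mono B1 B2 y) auto
      also have "\<dots> = ennreal (B1 * (norm y powr (1 - \<tau>) / norm y) + B2 * (norm y powr - (?n - 1) * norm y powr (?n - 1 - \<tau>)))"
        using B1(1) B2(1) by (subst ennreal_plus) (auto simp: ennreal_mult'[symmetric] mult_ac)
      also have "norm y powr (1 - \<tau>) / norm y = norm y powr - \<tau>"
        using y powr_add[of "norm y" "- \<tau>" 1] by simp
      also have "norm y powr - (?n - 1) * norm y powr (?n - 1 - \<tau>) = norm y powr - \<tau>"
        using y by (simp add: powr_add[symmetric])
      finally show "(\<integral>\<^sup>+x. ennreal (?k x y * norm x powr - \<tau>) \<partial>lborel) \<le> ennreal ((B1 + B2) * norm y powr - \<tau>)"
        by (simp add: distrib_right)
    qed (use N A1 A2 B1 B2 in auto)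
  qed (use A1 A2 B1 B2 in auto)
qed

section \<open>Integration by parts against test functions\<close>

lemma integrable_continuous_bounded_support:
  fixes f :: "'a::euclidean_space \<Rightarrow> real"
  assumes "continuous_on UNIV f" and "\<And>x. R < norm x \<Longrightarrow> f x = 0"
  shows "integrable lborel f"
proof -
  have "integrable lborel (\<lambda>x. indicator (cball 0 R) x *\<^sub>R f x)"
    using assms(1) by (intro borel_integrable_compact) (auto intro: continuous_on_subset)
  moreover have "(\<lambda>x. indicator (cball 0 R) x *\<^sub>R f x) = f"
    using assms(2) by (auto simp: fun_eq_iff indicator_def not_le)
  ultimately show ?thesis by simp
qed

lemma has_real_derivative_along_line:
  assumes "(f has_derivative f') (at (x + t *\<^sub>R e))"
  shows "((\<lambda>s. f (x + s *\<^sub>R e)) has_real_derivative f' e) (at t)"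
proof -
  interpret f': bounded_linear f' using assms by (rule has_derivative_bounded_linear)
  have "((\<lambda>s. f (x + s *\<^sub>R e)) has_derivative (\<lambda>h. f' (h *\<^sub>R e))) (at t)"
    by (rule has_derivative_compose[of "\<lambda>s. x + s *\<^sub>R e", OF _ assms])
      (auto intro!: derivative_eq_intros)
  then show ?thesis by (simp add: has_field_derivative_def f'.scaleR mult.commute[of _ "f' e"] mult_commute_abs)
qed

lemma diff_along_line_le:
  fixes f :: "'a::real_normed_vector \<Rightarrow> real"
  assumes "\<And>x. (f has_derivative f' x) (at x)"
    and "\<And>s. 0 \<le> s \<Longrightarrow> s \<le> t \<Longrightarrow> \<bar>f' (x + s *\<^sub>R e) e\<bar> \<le> B" and "0 \<le> t"
  shows "\<bar>f (x + t *\<^sub>R e) - f x\<bar> \<le> t * B"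
proof (cases "t = 0")
  case False
  then have "0 < t" using assms by simp
  then obtain z where z: "0 < z" "z < t" "f (x + t *\<^sub>R e) - f (x + 0 *\<^sub>R e) = (t - 0) * f' (x + z *\<^sub>R e) e"
    using MVT2[of 0 t "\<lambda>s. f (x + s *\<^sub>R e)" "\<lambda>s. f' (x + s *\<^sub>R e) e"]
      has_real_derivative_along_line[OF assms(1)] by auto
  then show ?thesis using assms(2)[of z] \<open>0 < t\<close> by (simp add: abs_mult)
qed simp

lemma has_derivative_zero_outside:
  assumes "(f has_derivative f') (at x)" and "open S" "x \<in> S" and "\<And>y. y \<in> S \<Longrightarrow> f y = 0"
  shows "f' h = 0"
proof -
  have "(f has_derivative (\<lambda>_. 0)) (at x)"
    by (rule has_derivative_transform_within_open[OF has_derivative_const assms(2,3)]) (simp add: assms(4))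
  then show ?thesis using has_derivative_unique[OF assms(1)] by (simp add: fun_eq_iff)
qed

text \<open>Translation invariance makes the integral of each difference quotient zero, and
  dominated convergence carries this over to the derivative. Continuity is asked of the derivative
  in direction \<open>e\<close> alone.\<close>

lemma integral_directional_derivative_eq_0:
  fixes f :: "'a::euclidean_space \<Rightarrow> real"
  assumes deriv: "\<And>x. (f has_derivative f' x) (at x)"
    and cont: "continuous_on UNIV (\<lambda>x. f' x e)" and supp: "\<And>x. R < norm x \<Longrightarrow> f x = 0"
  shows "(\<integral>x. f' x e \<partial>lborel) = 0"
proof -
  have cf: "continuous_on UNIV f"
    using deriv by (auto intro!: has_derivative_continuous_on simp: has_derivative_at_withinI)
  then have [measurable]: "f \<in> borel_measurable borel" by (rule borel_measurable_continuous_onI)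
  have intf: "integrable lborel f" using cf supp by (rule integrable_continuous_bounded_support)
  define t :: "nat \<Rightarrow> real" where "t n = 1 / (real n + 1)" for n
  have t: "0 < t n" "t n \<le> 1" for n by (auto simp: t_def)
  have t0: "t \<longlonglongrightarrow> 0" unfolding t_def using LIMSEQ_inverse_real_of_nat by (simp add: inverse_eq_divide add.commute)
  define s where "s n x = (f (x + t n *\<^sub>R e) - f x) / t n" for n x
  have "compact ((\<lambda>x. f' x e) ` cball 0 (R + 2 * norm e))"
    using cont by (intro compact_continuous_image) (auto intro: continuous_on_subset)
  then obtain B0 where "\<forall>y \<in> (\<lambda>x. f' x e) ` cball 0 (R + 2 * norm e). norm y \<le> B0"
    using compact_imp_bounded bounded_iff by metis
  then have B0: "\<bar>f' y e\<bar> \<le> B0" if "norm y \<le> R + 2 * norm e" for y using that by auto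
  \<comment> \<open>Steps have length at most |e|. Outside radius R + |e| both values of
    \<open>f\<close> vanish; inside, the segment stays within radius R + 2 |e|, where
    \<open>B0\<close> bounds the derivative.\<close>
  let ?W = "\<lambda>x. indicator (cball 0 (R + norm e)) x *\<^sub>R B0"
  have "(\<lambda>n. \<integral>x. s n x \<partial>lborel) \<longlonglongrightarrow> (\<integral>x. f' x e \<partial>lborel)"
  proof (rule integral_dominated_convergence[where w = ?W])
    show "(\<lambda>x. f' x e) \<in> borel_measurable lborel"
      using borel_measurable_continuous_onI[OF cont] by simp
    show "s n \<in> borel_measurable lborel" for n unfolding s_def by measurable
    show "integrable lborel ?W"
      by (intro borel_integrable_compact) auto
    show "AE x in lborel. (\<lambda>n. s n x) \<longlonglongrightarrow> f' x e"
    proof (rule AE_I2)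
      fix x
      have "((\<lambda>s. f (x + s *\<^sub>R e)) has_real_derivative f' x e) (at 0)"
        using has_real_derivative_along_line[of f "f' x" x 0 e] deriv[of x] by simp
      then have "((\<lambda>h. (f (x + h *\<^sub>R e) - f x) / h) \<longlongrightarrow> f' x e) (at 0)"
        by (simp add: DERIV_def)
      moreover have "filterlim t (at 0) sequentially"
        using t0 t(1) by (auto simp: filterlim_at eventually_sequentially less_imp_neq[symmetric])
      ultimately show "(\<lambda>n. s n x) \<longlonglongrightarrow> f' x e" unfolding s_def by (rule filterlim_compose)
    qed
    show "AE x in lborel. norm (s n x) \<le> ?W x" for n
    proof (rule AE_I2)
      fix x
      show "norm (s n x) \<le> ?W x"
      proof (cases "norm x \<le> R + norm e")
        case True
        have "\<bar>f (x + t n *\<^sub>R e) - f x\<bar> \<le> t n * B0"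
        proof (rule diff_along_line_le[OF deriv])
          fix s assume s: "0 \<le> s" "s \<le> t n"
          have "norm (x + s *\<^sub>R e) \<le> norm x + s * norm e" using s norm_triangle_ineq[of x "s *\<^sub>R e"] by simp
          moreover have "s * norm e \<le> 1 * norm e" using s t(2)[of n] by (intro mult_right_mono) auto
          ultimately show "\<bar>f' (x + s *\<^sub>R e) e\<bar> \<le> B0" using True by (intro B0) linarith
        qed (use t[of n] in auto)
        then show ?thesis using True t[of n] by (simp add: s_def field_simps)
      next
        case False
        have "norm x \<le> norm (x + t n *\<^sub>R e) + t n * norm e"
          using norm_triangle_ineq4[of "x + t n *\<^sub>R e" "t n *\<^sub>R e"] t[of n] by simp
        moreover have "t n * norm e \<le> 1 * norm e" using t(2)[of n] by (intro mult_right_mono) auto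
        moreover have "0 \<le> norm e" by simp
        ultimately have "R < norm x" "R < norm (x + t n *\<^sub>R e)" using False by linarith+
        then show ?thesis using False by (simp add: s_def supp)
      qed
    qed
  qed
  moreover have "(\<integral>x. s n x \<partial>lborel) = 0" for n
  proof -
    have eq: "(\<integral>x. f x \<partial>lborel) = (\<integral>x. f (x + t n *\<^sub>R e) \<partial>lborel)"
      using lborel_integral_affine[of f 1 "t n *\<^sub>R e"] by (simp add: add.commute)
    have "continuous_on UNIV (\<lambda>x. f (x + t n *\<^sub>R e))"
      by (intro continuous_on_compose2[OF cf] continuous_intros) auto
    moreover have "f (x + t n *\<^sub>R e) = 0" if "R + norm e < norm x" for x
    proof (rule supp)
      have "norm x \<le> norm (x + t n *\<^sub>R e) + t n * norm e"
        using norm_triangle_ineq4[of "x + t n *\<^sub>R e" "t n *\<^sub>R e"] t[of n] by simp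
      moreover have "t n * norm e \<le> 1 * norm e" using t(2)[of n] by (intro mult_right_mono) auto
      ultimately show "R < norm (x + t n *\<^sub>R e)" using that by linarith
    qed
    ultimately have "integrable lborel (\<lambda>x. f (x + t n *\<^sub>R e))"
      by (rule integrable_continuous_bounded_support)
    then show ?thesis using intf eq by (simp add: s_def)
  qed
  ultimately show ?thesis using LIMSEQ_unique[OF _ tendsto_const[of 0]] by simp
qed

section \<open>Calculus of punctured test functions\<close>

lemma ptf_continuous_partial_derivs:
  fixes u :: "real ^ 'n \<Rightarrow> real"
  assumes u: "u \<in> punctured_test_functions"
  shows ptf_has_derivative: "(u has_derivative (\<lambda>h. gradient u x \<bullet> h)) (at x)"
    and ptf_continuous: "continuous_on S u"
    and ptf_partial_deriv: "partial_deriv i u \<in> punctured_test_functions"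
proof -
  have sm: "C_diff k u" for k using u by (simp add: punctured_test_functions_def smooth_def)
  have d: "(u has_derivative frechet_derivative u (at x)) (at x)" for x
    using sm[of 1] by (simp flip: frechet_derivative_works)
  show deriv: "(u has_derivative (\<lambda>h. gradient u x \<bullet> h)) (at x)" for x
  proof -
    interpret l: bounded_linear "frechet_derivative u (at x)" using d by (rule has_derivative_bounded_linear)
    have "frechet_derivative u (at x) h = gradient u x \<bullet> h" for h
    proof -
      have "frechet_derivative u (at x) h = frechet_derivative u (at x) (\<Sum>i\<in>UNIV. (h $ i) *\<^sub>R axis i 1)"
        using basis_expansion[of h] by (simp add: scalar_mult_eq_scaleR)
      then show ?thesis
        by (simp add: l.sum l.scaleR inner_vec_def gradient_def partial_deriv_def mult.commute)
    qed
    then show ?thesis using d[of x] by presburger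
  qed
  show "continuous_on S u"
    using sm[of 0] by (auto intro: continuous_on_subset)
  \<comment> \<open>Differentiation does not enlarge the support. This closure property lets every
    fact about \<open>u\<close> be reused for its first and second partial derivatives.\<close>
  show "partial_deriv i u \<in> punctured_test_functions"
  proof -
    have "C_diff k (partial_deriv i u)" for k
      using sm[of "Suc k"] unfolding partial_deriv_def[abs_def] by simp
    then have 1: "smooth (partial_deriv i u)" by (simp add: smooth_def)
    let ?S = "closure (support_on UNIV u)"
    have "partial_deriv i u x = 0" if "x \<notin> ?S" for x
      unfolding partial_deriv_def
    proof (rule has_derivative_zero_outside[OF d])
      show "open (- ?S)" by auto
      show "u y = 0" if "y \<in> - ?S" for y
        using that closure_subset[of "support_on UNIV u"] by (auto simp: support_on_def)
    qed (use that in auto)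
    then have "support_on UNIV (partial_deriv i u) \<subseteq> ?S" by (auto simp: support_on_def)
    then have sub: "closure (support_on UNIV (partial_deriv i u)) \<subseteq> ?S" by (simp add: closure_minimal)
    moreover have "compact (closure (support_on UNIV (partial_deriv i u)))"
      using u compact_Int_closed[of ?S "closure (support_on UNIV (partial_deriv i u))"] sub
      by (simp add: punctured_test_functions_def Int_absorb1)
    ultimately show ?thesis using u 1 by (auto simp: punctured_test_functions_def)
  qed
qed

lemma ptf_vanishes:
  fixes u :: "real ^ 'n \<Rightarrow> real"
  assumes u: "u \<in> punctured_test_functions"
  obtains r R where "0 < r" "0 < R" "\<And>x. norm x < r \<Longrightarrow> u x = 0" "\<And>x. R < norm x \<Longrightarrow> u x = 0"
proof -
  let ?S = "closure (support_on UNIV u)"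
  have z: "u x = 0" if "x \<notin> ?S" for x
    using that closure_subset[of "support_on UNIV u"] by (auto simp: support_on_def)
  have "bounded ?S" using u by (auto simp: punctured_test_functions_def compact_imp_bounded)
  then obtain R where R: "0 < R" "\<forall>x\<in>?S. norm x \<le> R" by (auto simp: bounded_pos)
  have "open (- ?S)" "0 \<in> - ?S" using u by (auto simp: punctured_test_functions_def)
  then obtain r where r: "0 < r" "ball 0 r \<subseteq> - ?S" unfolding open_contains_ball by blast
  show ?thesis
  proof (rule that[OF r(1) R(1)])
    show "u x = 0" if "norm x < r" for x using z r that by auto
    show "u x = 0" if "R < norm x" for x using z[of x] R(2) that by force
  qed
qed

text \<open>The product \<open>f * u\<close> has bounded support whatever the growth of
  \<open>f\<close>, so the integral of its derivative vanishes. The integrability statements are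
  exported because sums of such integrals are formed later.\<close>

lemma integral_by_parts_ptf:
  fixes f :: "real ^ 'n \<Rightarrow> real"
  assumes deriv: "\<And>x. (f has_derivative f' x) (at x)"
    and cont: "continuous_on UNIV (\<lambda>x. f' x (axis j 1))" and u: "u \<in> punctured_test_functions"
  shows "integrable lborel (\<lambda>x. f x * partial_deriv j u x)"
    and "integrable lborel (\<lambda>x. f' x (axis j 1) * u x)"
    and "(\<integral>x. f x * partial_deriv j u x \<partial>lborel) = - (\<integral>x. f' x (axis j 1) * u x \<partial>lborel)"
proof -
  let ?e = "axis j (1::real)"
  have cf: "continuous_on UNIV f"
    using deriv by (auto intro!: has_derivative_continuous_on simp: has_derivative_at_withinI)
  obtain R where R: "\<And>x. R < norm x \<Longrightarrow> u x = 0" using ptf_vanishes[OF u] by metis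
  obtain R' where R': "\<And>x. R' < norm x \<Longrightarrow> partial_deriv j u x = 0"
    using ptf_vanishes[OF ptf_partial_deriv[OF u]] by metis
  have pd: "gradient u x \<bullet> ?e = partial_deriv j u x" for x by (simp add: inner_axis gradient_def)
  have cu: "continuous_on UNIV u" "continuous_on UNIV (partial_deriv j u)"
    using u by (auto intro!: ptf_continuous ptf_partial_deriv)
  show i1: "integrable lborel (\<lambda>x. f x * partial_deriv j u x)"
    using cf cu R' by (intro integrable_continuous_bounded_support[where R = R'] continuous_intros) auto
  show i2: "integrable lborel (\<lambda>x. f' x (axis j 1) * u x)"
    using cont cu R by (intro integrable_continuous_bounded_support[where R = R] continuous_intros) auto
  have "(\<integral>x. f x * (gradient u x \<bullet> ?e) + f' x ?e * u x \<partial>lborel) = 0"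
  proof (rule integral_directional_derivative_eq_0[where f = "\<lambda>x. f x * u x" and R = R])
    show "((\<lambda>x. f x * u x) has_derivative (\<lambda>h. f x * (gradient u x \<bullet> h) + f' x h * u x)) (at x)" for x
      by (rule has_derivative_mult[OF deriv ptf_has_derivative[OF u]])
    show "continuous_on UNIV (\<lambda>x. f x * (gradient u x \<bullet> ?e) + f' x ?e * u x)"
      unfolding pd using cf cu cont by (intro continuous_intros)
  qed (simp add: R)
  then show "(\<integral>x. f x * partial_deriv j u x \<partial>lborel) = - (\<integral>x. f' x (axis j 1) * u x \<partial>lborel)"
    using i1 i2 by (simp add: pd)
qed

section \<open>The regularized kernel\<close>

text \<open>With r = -N/2 this replaces |z|^-N by a function without singularity: for \<epsilon> > 0
  the base is positive, so \<open>powr\<close> is differentiable also at z = 0.\<close>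

definition reg_powr :: "real \<Rightarrow> real \<Rightarrow> 'a::real_inner \<Rightarrow> real" where
  "reg_powr \<epsilon> r z = (z \<bullet> z + \<epsilon>\<^sup>2) powr r"

lemma reg_powr_base_pos: "0 < \<epsilon> \<Longrightarrow> 0 < z \<bullet> z + \<epsilon>\<^sup>2" for z :: "'a::real_inner"
  by (simp add: add_nonneg_pos)

lemma reg_powr_nonneg: "0 \<le> reg_powr \<epsilon> r z"
  by (simp add: reg_powr_def)

lemma continuous_on_reg_powr [continuous_intros]:
  assumes "0 < \<epsilon>" "continuous_on S f"
  shows "continuous_on S (\<lambda>y. reg_powr \<epsilon> r (f y))"
  unfolding reg_powr_def
  using assms by (intro continuous_intros) (metis less_irrefl reg_powr_base_pos)+

lemma has_derivative_reg_powr: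
  fixes x y :: "'a::real_inner"
  assumes "0 < \<epsilon>"
  shows "((\<lambda>y. reg_powr \<epsilon> r (y - x)) has_derivative
    (\<lambda>h. 2 * r * ((y - x) \<bullet> h) * reg_powr \<epsilon> (r - 1) (y - x))) (at y)"
proof -
  have "((\<lambda>z. z powr r) has_real_derivative r * ((y - x) \<bullet> (y - x) + \<epsilon>\<^sup>2) powr (r - 1))
      (at ((y - x) \<bullet> (y - x) + \<epsilon>\<^sup>2))"
    using reg_powr_base_pos[OF assms] by (rule has_real_derivative_powr)
  moreover have "((\<lambda>y. (y - x) \<bullet> (y - x) + \<epsilon>\<^sup>2) has_derivative (\<lambda>h. 2 * ((y - x) \<bullet> h))) (at y)"
    by (auto intro!: derivative_eq_intros simp: inner_commute)
  ultimately have "((\<lambda>y. ((y - x) \<bullet> (y - x) + \<epsilon>\<^sup>2) powr r) has_derivative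
     (\<lambda>h. 2 * ((y - x) \<bullet> h) * (r * ((y - x) \<bullet> (y - x) + \<epsilon>\<^sup>2) powr (r - 1)))) (at y)"
    by (rule DERIV_compose_FDERIV)
  then show ?thesis by (simp add: reg_powr_def mult_ac)
qed

lemma has_derivative_vec_nth_diff:
  fixes x y :: "real ^ 'n"
  shows "((\<lambda>y. (y - x) $ i) has_derivative (\<lambda>h. h $ i)) (at y)"
  by (rule bounded_linear.has_derivative[OF bounded_linear_vec_nth]) (auto intro!: derivative_eq_intros)

lemma has_derivative_vec_nth_mult_reg_powr:
  fixes x y :: "real ^ 'n"
  assumes "0 < \<epsilon>"
  shows "((\<lambda>y. (y - x) $ i * reg_powr \<epsilon> r (y - x)) has_derivative
    (\<lambda>h. h $ i * reg_powr \<epsilon> r (y - x)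
      + 2 * r * (y - x) $ i * ((y - x) \<bullet> h) * reg_powr \<epsilon> (r - 1) (y - x))) (at y)"
proof -
  from has_derivative_mult[OF has_derivative_vec_nth_diff has_derivative_reg_powr[OF assms, of r x y]] show ?thesis
    by (simp add: algebra_simps)
qed

text \<open>\<open>z \<bullet> z\<close> is the base of the power less
  \<open>\<epsilon>\<^sup>2\<close>. The surplus term is what survives when the leading terms of the
  differentiated kernel cancel.\<close>

lemma inner_self_mult_reg_powr:
  fixes z :: "'a::real_inner"
  assumes "0 < \<epsilon>"
  shows "(z \<bullet> z) * reg_powr \<epsilon> (r - 1) z = reg_powr \<epsilon> r z - \<epsilon>\<^sup>2 * reg_powr \<epsilon> (r - 1) z"
  using powr_add[of "z \<bullet> z + \<epsilon>\<^sup>2" "r - 1" 1] reg_powr_base_pos[OF assms, of z]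
  by (simp add: reg_powr_def algebra_simps)

text \<open>Let \<open>r = -N/2\<close> and \<open>K z = z (\<bar>z\<bar>\<^sup>2 + \<epsilon>\<^sup>2) powr r\<close>. Then \<open>div K = N \<epsilon>\<^sup>2 (\<bar>z\<bar>\<^sup>2 + \<epsilon>\<^sup>2) powr (r - 1)\<close>, and
  \<open>\<Delta> K\<^sub>i = \<partial>\<^sub>i div K\<close> because \<open>K\<close> is a gradient. Moving the whole Laplacian onto the explicit kernel avoids
  interchanging partial derivatives of \<open>u\<close>.\<close>

lemma integral_kernel_laplacian:
  fixes u :: "real ^ 'n \<Rightarrow> real"
  assumes u: "u \<in> punctured_test_functions" and \<epsilon>: "0 < \<epsilon>"
  shows "(\<integral>y. (y - x) $ i * reg_powr \<epsilon> (- real CARD('n) / 2) (y - x) * laplacian u y \<partial>lborel)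
    = - (\<integral>y. real CARD('n) * \<epsilon>\<^sup>2 * reg_powr \<epsilon> (- real CARD('n) / 2 - 1) (y - x) * partial_deriv i u y \<partial>lborel)"
proof -
  define n r where "n = real CARD('n)" and "r = - n / 2"
  define P where "P s y = reg_powr \<epsilon> s (y - x)" for s y
  define \<delta> :: "'n \<Rightarrow> real" where "\<delta> j = (if i = j then 1 else 0)" for j
  \<comment> \<open>\<open>K\<close> is one component of the kernel, \<open>K1 j\<close> and
    \<open>K2 j\<close> are its first and second partial derivatives in direction j, and
    \<open>H1\<close> is the i-th partial derivative of the divergence \<open>H\<close>.\<close>
  define K where "K y = (y - x) $ i * P r y" for y
  define K1 where "K1 j y = \<delta> j * P r y + 2 * r * (((y - x) $ i * (y - x) $ j) * P (r - 1) y)" for j y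
  define K2 where "K2 j y = \<delta> j * (2 * r * (y - x) $ j * P (r - 1) y)
      + 2 * r * ((\<delta> j * (y - x) $ j + (y - x) $ i) * P (r - 1) y
        + ((y - x) $ i * (y - x) $ j) * (2 * (r - 1) * (y - x) $ j * P (r - 2) y))" for j y
  define H where "H y = n * \<epsilon>\<^sup>2 * P (r - 1) y" for y
  define H1 where "H1 y = n * \<epsilon>\<^sup>2 * (2 * (r - 1) * (y - x) $ i * P (r - 2) y)" for y
  note P = has_derivative_reg_powr[OF \<epsilon>, of _ x, folded P_def]
  have ax: "axis j 1 $ i = \<delta> j" for j by (simp add: \<delta>_def axis_def)
  have cP: "continuous_on UNIV (P s)" for s
    unfolding P_def by (intro continuous_intros \<epsilon>)
  have pu: "partial_deriv j u \<in> punctured_test_functions" for j using u by (rule ptf_partial_deriv)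

  let ?K' = "\<lambda>y h. h $ i * P r y + 2 * r * (y - x) $ i * ((y - x) \<bullet> h) * P (r - 1) y"
  have K': "?K' y (axis j 1) = K1 j y" for j y by (simp add: K1_def ax inner_axis mult.assoc)
  have K: "(K has_derivative ?K' y) (at y)" for y
    using has_derivative_vec_nth_mult_reg_powr[OF \<epsilon>] by (simp add: K_def[abs_def] P_def)
  have cK1: "continuous_on UNIV (K1 j)" for j
    unfolding K1_def by (intro continuous_intros cP)

  let ?K1' = "\<lambda>j y h. \<delta> j * (2 * r * ((y - x) \<bullet> h) * P (r - 1) y)
      + 2 * r * ((h $ i * (y - x) $ j + (y - x) $ i * h $ j) * P (r - 1) y
        + ((y - x) $ i * (y - x) $ j) * (2 * (r - 1) * ((y - x) \<bullet> h) * P (r - 2) y))"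
  have K1': "?K1' j y (axis j 1) = K2 j y" for j y by (simp add: K2_def ax inner_axis)
  have K1: "(K1 j has_derivative ?K1' j y) (at y)" for j y
  proof -
    have "r - 1 - 1 = r - 2" by simp
    note P1 = P[of "r - 1" y, unfolded this]
    have 1: "((\<lambda>y. (y - x) $ i * (y - x) $ j) has_derivative (\<lambda>h. (y - x) $ i * h $ j + h $ i * (y - x) $ j)) (at y)"
      by (intro has_derivative_mult has_derivative_vec_nth_diff)
    from has_derivative_add[OF has_derivative_mult_right[OF P[of r y], of "\<delta> j"]
        has_derivative_mult_right[OF has_derivative_mult[OF 1 P1], of "2 * r"]]
    show ?thesis unfolding K1_def by (rule has_derivative_eq_rhs) (auto simp: K1_def algebra_simps)
  qed
  have cK2: "continuous_on UNIV (K2 j)" for j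
    unfolding K2_def by (intro continuous_intros cP)

  let ?H' = "\<lambda>y h. n * \<epsilon>\<^sup>2 * (2 * (r - 1) * ((y - x) \<bullet> h) * P (r - 2) y)"
  have H': "?H' y (axis i 1) = H1 y" for y by (simp add: H1_def inner_axis)
  have H: "(H has_derivative ?H' y) (at y)" for y
  proof -
    have "r - 1 - 1 = r - 2" by simp
    note P1 = P[of "r - 1" y, unfolded this]
    from has_derivative_mult_right[OF P1, of "n * \<epsilon>\<^sup>2"] show ?thesis by (simp add: H_def[abs_def] mult.assoc)
  qed
  have cH1: "continuous_on UNIV H1" unfolding H1_def by (intro continuous_intros cP)

  \<comment> \<open>The terms in \<open>P (r - 1)\<close> add up to the coefficient 2 r (N + 2 r),
    which vanishes for r = -N/2; the \<open>\<epsilon>\<^sup>2\<close> term remains.\<close>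
  have K2_sum: "(\<Sum>j\<in>UNIV. K2 j y) = H1 y" for y
  proof -
    define z where "z = y - x"
    have s1: "(\<Sum>j\<in>UNIV. \<delta> j * z $ j) = z $ i"
      by (simp add: \<delta>_def if_distrib[of "\<lambda>c. c * _"] cong: if_cong)
    have s2: "(\<Sum>j\<in>UNIV. z $ j * z $ j) = z \<bullet> z" by (simp add: inner_vec_def)
    have s3: "(\<Sum>j\<in>(UNIV::'n set). z $ i) = n * z $ i" by (simp add: n_def)
    have "K2 j y = (4 * r * P (r - 1) y) * (\<delta> j * z $ j) + (2 * r * P (r - 1) y) * z $ i
        + (4 * r * (r - 1) * z $ i * P (r - 2) y) * (z $ j * z $ j)" for j
      by (simp add: K2_def z_def algebra_simps)
    then have "(\<Sum>j\<in>UNIV. K2 j y) = (4 * r * P (r - 1) y) * z $ i + (2 * r * P (r - 1) y) * (n * z $ i)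
        + (4 * r * (r - 1) * z $ i * P (r - 2) y) * (z \<bullet> z)"
      by (simp only: sum.distrib sum_distrib_left[symmetric] s1 s2 s3)
    also have "\<dots> = (4 * r + 2 * r * n) * z $ i * P (r - 1) y + 4 * r * (r - 1) * z $ i * ((z \<bullet> z) * P (r - 2) y)"
      by (simp add: algebra_simps)
    also have "(z \<bullet> z) * P (r - 2) y = P (r - 1) y - \<epsilon>\<^sup>2 * P (r - 2) y"
      using inner_self_mult_reg_powr[OF \<epsilon>, of z "r - 1"] by (simp add: P_def z_def)
    also have "(4 * r + 2 * r * n) * z $ i * P (r - 1) y + 4 * r * (r - 1) * z $ i * (P (r - 1) y - \<epsilon>\<^sup>2 * P (r - 2) y) = H1 y"
      by (simp add: H1_def z_def r_def algebra_simps)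
    finally show ?thesis .
  qed

  have "(\<integral>y. K y * laplacian u y \<partial>lborel) = (\<integral>y. (\<Sum>j\<in>UNIV. K y * partial_deriv j (partial_deriv j u) y) \<partial>lborel)"
    by (simp add: laplacian_def sum_distrib_left)
  also have "\<dots> = (\<Sum>j\<in>UNIV. \<integral>y. K y * partial_deriv j (partial_deriv j u) y \<partial>lborel)"
    by (intro Bochner_Integration.integral_sum integral_by_parts_ptf(1)[OF K] pu) (simp only: K' cK1)
  also have "\<dots> = (\<Sum>j\<in>UNIV. - (\<integral>y. K1 j y * partial_deriv j u y \<partial>lborel))"
    using integral_by_parts_ptf(3)[OF K _ pu] cK1 by (intro sum.cong refl) (simp only: K')
  also have "\<dots> = (\<Sum>j\<in>UNIV. \<integral>y. K2 j y * u y \<partial>lborel)"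
    using integral_by_parts_ptf(3)[OF K1 _ u] cK2 by (intro sum.cong refl) (simp only: K1' minus_minus)
  also have "\<dots> = (\<integral>y. (\<Sum>j\<in>UNIV. K2 j y * u y) \<partial>lborel)"
  proof (rule Bochner_Integration.integral_sum[symmetric])
    show "integrable lborel (\<lambda>y. K2 j y * u y)" for j
      using integral_by_parts_ptf(2)[OF K1 _ u, of j j] cK2 by (simp only: K1')
  qed
  also have "\<dots> = (\<integral>y. H1 y * u y \<partial>lborel)"
    by (simp add: sum_distrib_right[symmetric] K2_sum)
  \<comment> \<open>The third integration by parts returns one derivative to \<open>u\<close>, so
    that the approximate identity \<open>H\<close> is tested against
    \<open>partial_deriv i u\<close>.\<close>
  also have "\<dots> = - (\<integral>y. H y * partial_deriv i u y \<partial>lborel)"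
    using integral_by_parts_ptf(3)[OF H _ u, of i] cH1 by (simp only: H' minus_minus)
  finally show ?thesis by (simp add: K_def H_def P_def n_def r_def)
qed

section \<open>The approximate identity and its mass\<close>

lemma integrable_reg_powr:
  "integrable lborel (\<lambda>z::'a::euclidean_space. reg_powr 1 (- real DIM('a) / 2 - 1) z)"
proof (rule integrableI_bounded)
  let ?n = "real DIM('a)"
  show "(\<lambda>z::'a. reg_powr 1 (- ?n / 2 - 1) z) \<in> borel_measurable lborel"
    unfolding reg_powr_def by measurable
  obtain C where C: "0 \<le> C" "\<And>r. 0 < r \<Longrightarrow>
      (\<integral>\<^sup>+y. indicator {y. r \<le> norm y} y * ennreal (norm (y::'a) powr - (?n + 2)) \<partial>lborel)
        \<le> ennreal (C * r powr (?n - (?n + 2)))"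
    using nn_integral_norm_powr_outside[of "?n + 2", where 'a='a] by auto
  have "(\<integral>\<^sup>+z. ennreal (norm (reg_powr 1 (- ?n / 2 - 1) (z::'a))) \<partial>lborel)
    \<le> (\<integral>\<^sup>+z. indicator (cball 0 1) z + indicator {y. 1 \<le> norm y} z * ennreal (norm (z::'a) powr - (?n + 2)) \<partial>lborel)"
  proof (rule nn_integral_mono)
    fix z :: 'a
    \<comment> \<open>On the unit ball the base is at least 1 and the exponent negative; outside,
      the decay order N + 2 exceeds the dimension.\<close>
    have "reg_powr 1 (- ?n / 2 - 1) z \<le> 1"
      unfolding reg_powr_def using powr_mono[of "- ?n / 2 - 1" 0 "z \<bullet> z + 1"] by (simp add: add_nonneg_eq_0_iff)
    moreover have "reg_powr 1 (- ?n / 2 - 1) z \<le> norm z powr - (?n + 2)" if "1 \<le> norm z"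
    proof -
      have "reg_powr 1 (- ?n / 2 - 1) z \<le> ((norm z)\<^sup>2) powr (- ?n / 2 - 1)"
        unfolding reg_powr_def power2_norm_eq_inner using that
        by (intro powr_mono2') auto
      also have "\<dots> = (norm z powr 2) powr (- ?n / 2 - 1)"
        using that by (subst powr_numeral) auto
      also have "\<dots> = norm z powr - (?n + 2)"
        unfolding powr_powr by (rule arg_cong[of _ _ "(powr) (norm z)"]) (simp add: field_simps)
      finally show ?thesis .
    qed
    ultimately show "ennreal (norm (reg_powr 1 (- ?n / 2 - 1) z))
       \<le> indicator (cball 0 1) z + indicator {y. 1 \<le> norm y} z * ennreal (norm z powr - (?n + 2))"
      using reg_powr_nonneg[of 1 "- ?n / 2 - 1" z]
      by (cases "norm z \<le> 1") (auto simp: add_increasing2 ennreal_leI)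
  qed
  also have "\<dots> = emeasure lborel (cball (0::'a) 1)
      + (\<integral>\<^sup>+z. indicator {y. 1 \<le> norm y} z * ennreal (norm (z::'a) powr - (?n + 2)) \<partial>lborel)"
    by (subst nn_integral_add) (auto simp: borel_closed intro!: borel_measurable_indicator)
  also have "\<dots> < \<infinity>"
    using C(2)[of 1] emeasure_lborel_cball_finite[of "0::'a" 1]
    by (simp add: less_top[symmetric]) (metis ennreal_less_top le_less_trans less_top)
  finally show "(\<integral>\<^sup>+z. ennreal (norm (reg_powr 1 (- ?n / 2 - 1) (z::'a))) \<partial>lborel) < \<infinity>" .
qed

text \<open>Normalizing constant: the mass of the divergence of the kernel at \<epsilon> = 1 and, by
  scaling, at every \<epsilon> > 0. As the limit of the flux of the kernel through large spheres it
  is the area of the unit sphere.\<close>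

definition kernel_mass :: "'a::euclidean_space itself \<Rightarrow> real" where
  "kernel_mass _ = (\<integral>z. real DIM('a) * reg_powr 1 (- real DIM('a) / 2 - 1) (z::'a) \<partial>lborel)"

lemma kernel_mass_pos: "0 < kernel_mass TYPE('a::euclidean_space)"
proof -
  let ?f = "\<lambda>z::'a. real DIM('a) * reg_powr 1 (- real DIM('a) / 2 - 1) z"
  have pos: "0 < ?f z" for z
    using reg_powr_base_pos[of 1 z] by (simp add: reg_powr_def)
  have int: "integrable lborel ?f" by (intro integrable_mult_right integrable_reg_powr)
  have "kernel_mass TYPE('a) \<noteq> 0"
  proof
    assume "kernel_mass TYPE('a) = 0"
    then have "AE z in lborel. ?f z = 0"
      unfolding kernel_mass_def using integral_nonneg_eq_0_iff_AE[OF int] pos by (simp add: less_imp_le)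
    then have "AE z in (lborel :: 'a measure). False"
      by (rule eventually_mono) (use pos in \<open>metis less_irrefl\<close>)
    then show False by (simp add: AE_iff_measurable[of UNIV])
  qed
  moreover have "0 \<le> kernel_mass TYPE('a)"
    unfolding kernel_mass_def using pos by (intro integral_nonneg_AE AE_I2 less_imp_le)
  ultimately show ?thesis by simp
qed

text \<open>Substituting y = x + e z moves the parameter into the argument of \<open>v\<close>: the
  Jacobian e^N, the prefactor e^2 and the power e^(-N - 2) from the kernel cancel. The weight is
  then fixed and integrable, and dominated convergence applies.\<close>

lemma tendsto_integral_approximate_identity:
  fixes v :: "'a::euclidean_space \<Rightarrow> real"
  assumes cont: "continuous_on UNIV v" and bound: "\<And>y. \<bar>v y\<bar> \<le> B"
    and \<epsilon>: "\<And>k. 0 < \<epsilon> k" "\<epsilon> \<longlonglongrightarrow> 0"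
  shows "(\<lambda>k. \<integral>y. real DIM('a) * (\<epsilon> k)\<^sup>2 * reg_powr (\<epsilon> k) (- real DIM('a) / 2 - 1) (y - x) * v y \<partial>lborel)
    \<longlonglongrightarrow> kernel_mass TYPE('a) * v x"
proof -
  let ?n = "real DIM('a)"
  let ?\<eta> = "\<lambda>z::'a. ?n * reg_powr 1 (- ?n / 2 - 1) z"
  have [measurable]: "v \<in> borel_measurable borel" using cont by (rule borel_measurable_continuous_onI)
  have [measurable]: "(\<lambda>z::'a. reg_powr e s (z - x)) \<in> borel_measurable borel" for e s x
    unfolding reg_powr_def by measurable
  have [measurable]: "(\<lambda>z::'a. reg_powr e s z) \<in> borel_measurable borel" for e s
    unfolding reg_powr_def by measurable
  have eq: "(\<integral>y. ?n * e\<^sup>2 * reg_powr e (- ?n / 2 - 1) (y - x) * v y \<partial>lborel) = (\<integral>z. ?\<eta> z * v (x + e *\<^sub>R z) \<partial>lborel)"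
    if e: "0 < e" for e
  proof -
    have "e ^ DIM('a) * (?n * e\<^sup>2 * reg_powr e (- ?n / 2 - 1) (e *\<^sub>R z)) = ?\<eta> z" for z :: 'a
    proof -
      have "reg_powr e (- ?n / 2 - 1) (e *\<^sub>R z) = (e\<^sup>2 * (z \<bullet> z + 1)) powr (- ?n / 2 - 1)"
        by (simp add: reg_powr_def algebra_simps power2_eq_square)
      also have "\<dots> = (e powr 2) powr (- ?n / 2 - 1) * reg_powr 1 (- ?n / 2 - 1) z"
        using e by (simp add: powr_mult reg_powr_def)
      also have "(e powr 2) powr (- ?n / 2 - 1) = e powr (- ?n - 2)"
        unfolding powr_powr by (rule arg_cong[of _ _ "(powr) e"]) (simp add: field_simps)
      finally have 1: "reg_powr e (- ?n / 2 - 1) (e *\<^sub>R z) = e powr (- ?n - 2) * reg_powr 1 (- ?n / 2 - 1) z" .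
      have "e ^ DIM('a) * e\<^sup>2 * e powr (- ?n - 2) = e powr ?n * e powr 2 * e powr (- ?n - 2)"
        using e by (simp add: powr_realpow)
      also have "\<dots> = 1" using e by (simp only: powr_add[symmetric]) simp
      finally have "e ^ DIM('a) * e\<^sup>2 * e powr (- ?n - 2) = 1" .
      then show ?thesis unfolding 1 by (simp add: mult_ac)
    qed
    note sc = this
    have "(\<integral>y. ?n * e\<^sup>2 * reg_powr e (- ?n / 2 - 1) (y - x) * v y \<partial>lborel)
      = e ^ DIM('a) * (\<integral>z. ?n * e\<^sup>2 * reg_powr e (- ?n / 2 - 1) (e *\<^sub>R z) * v (x + e *\<^sub>R z) \<partial>lborel)"
      using e by (subst lborel_integral_affine[of _ e x]) auto
    also have "\<dots> = (\<integral>z. e ^ DIM('a) * (?n * e\<^sup>2 * reg_powr e (- ?n / 2 - 1) (e *\<^sub>R z)) * v (x + e *\<^sub>R z) \<partial>lborel)"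
      by (simp add: mult.assoc)
    finally show ?thesis unfolding sc .
  qed
  have "(\<lambda>k. \<integral>z. ?\<eta> z * v (x + \<epsilon> k *\<^sub>R z) \<partial>lborel) \<longlonglongrightarrow> (\<integral>z. ?\<eta> z * v x \<partial>lborel)"
  proof (rule integral_dominated_convergence[where w = "\<lambda>z. ?\<eta> z * B"])
    show "integrable lborel (\<lambda>z. ?\<eta> z * B)"
      by (intro integrable_mult_right integrable_mult_left integrable_reg_powr)
    show "AE z in lborel. (\<lambda>k. ?\<eta> z * v (x + \<epsilon> k *\<^sub>R z)) \<longlonglongrightarrow> ?\<eta> z * v x"
    proof (rule AE_I2)
      fix z
      have "(\<lambda>k. x + \<epsilon> k *\<^sub>R z) \<longlonglongrightarrow> x + 0 *\<^sub>R z" by (intro tendsto_intros \<epsilon>)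
      moreover have "isCont v x" using cont by (simp add: continuous_on_eq_continuous_at)
      ultimately show "(\<lambda>k. ?\<eta> z * v (x + \<epsilon> k *\<^sub>R z)) \<longlonglongrightarrow> ?\<eta> z * v x"
        by (intro tendsto_mult_left isCont_tendsto_compose[of x v]) auto
    qed
    show "AE z in lborel. norm (?\<eta> z * v (x + \<epsilon> k *\<^sub>R z)) \<le> ?\<eta> z * B" for k
      by (intro AE_I2) (simp add: abs_mult mult_left_mono[OF bound reg_powr_nonneg] abs_of_nonneg[OF reg_powr_nonneg])
  qed measurable
  also have "(\<integral>z. ?\<eta> z * v x \<partial>lborel) = kernel_mass TYPE('a) * v x"
    unfolding kernel_mass_def by simp
  finally show ?thesis by (simp only: eq[OF \<epsilon>(1)])
qed

section \<open>Pointwise gradient bounds\<close>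

lemma reg_powr_le_norm_powr:
  assumes "z \<noteq> 0" "0 \<le> r"
  shows "reg_powr \<epsilon> (- r / 2) z \<le> norm z powr - r"
proof -
  have "reg_powr \<epsilon> (- r / 2) z \<le> (z \<bullet> z) powr (- r / 2)"
    unfolding reg_powr_def using assms by (intro powr_mono2') auto
  also have "\<dots> = (norm z powr 2) powr (- r / 2)"
    using assms by (simp add: power2_norm_eq_inner)
  also have "\<dots> = norm z powr - r" unfolding powr_powr by simp
  finally show ?thesis .
qed

text \<open>The bound does not involve \<epsilon>, so it passes to the limit. At z = 0 both sides
  are \<open>0\<close>, since \<open>0 powr\<close> is \<open>0\<close> for every exponent.\<close>

lemma abs_kernel_le:
  fixes z :: "real ^ 'n"
  shows "\<bar>z $ i * reg_powr \<epsilon> (- real CARD('n) / 2) z\<bar> \<le> norm z powr - (real CARD('n) - 1)"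
proof (cases "z = 0")
  case False
  have "\<bar>z $ i * reg_powr \<epsilon> (- real CARD('n) / 2) z\<bar> \<le> norm z * norm z powr - real CARD('n)"
    using False reg_powr_nonneg[of \<epsilon> "- real CARD('n) / 2" z]
    by (simp only: abs_mult abs_of_nonneg)
      (intro mult_mono component_le_norm_cart reg_powr_le_norm_powr, auto)
  also have "\<dots> = norm z powr - (real CARD('n) - 1)"
    using False powr_add[of "norm z" 1 "- real CARD('n)"] by simp
  finally show ?thesis .
qed simp

text \<open>For |y| < 2 |x| the quotient |x|/max is bounded below and the triangle inequality is
  enough. Otherwise the segment from y to y - x stays at distance at least |y|/2 from the origin,
  where the derivative of the kernel has order |z|^-N. The right side is written so that one
  expression serves both regimes; n + 1 collects the two terms of the derivative and 2^n comes from
  halving |y|.\<close>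

lemma abs_kernel_diff_le:
  fixes x y :: "real ^ 'n" and i :: 'n
  assumes \<epsilon>: "0 < \<epsilon>"
  defines "n \<equiv> real CARD('n)"
  defines "K \<equiv> \<lambda>z::real ^ 'n. z $ i * reg_powr \<epsilon> (- n / 2) z"
  shows "\<bar>K (y - x) - K y\<bar> \<le> (n + 1) * 2 powr n *
    (norm x * ((norm (x - y) powr - (n - 1) + norm y powr - (n - 1)) / max (norm x) (norm y)))"
proof -
  have n: "1 \<le> n" unfolding n_def by (simp add: Suc_leI)
  have "2 powr 1 \<le> 2 powr n" using n by (intro powr_mono) auto
  then have C2: "2 \<le> 2 powr n" by simp
  let ?S = "norm (x - y) powr - (n - 1) + norm y powr - (n - 1)"
  have S: "0 \<le> ?S" by simp
  consider "y = 0 \<and> x = 0" | "norm y < 2 * norm x" | "2 * norm x \<le> norm y" "y \<noteq> 0"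
    by fastforce
  then show ?thesis
  proof cases
    case 2
    then have "0 < norm x" using norm_ge_zero[of y] by linarith
    then have m: "0 < max (norm x) (norm y)" by (simp add: less_max_iff_disj)
    have "norm y < 2 * norm x" "norm x \<le> 2 * norm x" using 2 by auto
    then have "max (norm x) (norm y) \<le> 2 * norm x" by simp
    \<comment> \<open>A factor at least 1 that contains |x|/max, inserted below at no cost.\<close>
    then have r: "1 \<le> 2 * (norm x / max (norm x) (norm y))" using m by (simp add: field_simps)
    have "\<bar>K (y - x) - K y\<bar> \<le> \<bar>K (y - x)\<bar> + \<bar>K y\<bar>" by simp
    also have "\<dots> \<le> norm (y - x) powr - (n - 1) + norm y powr - (n - 1)"
      unfolding K_def n_def by (intro add_mono abs_kernel_le)
    also have "\<dots> = 1 * 1 * ?S" by (simp add: norm_minus_commute)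
    also have "\<dots> \<le> (n + 1) * (2 * (norm x / max (norm x) (norm y))) * ?S"
      using r n S by (intro mult_right_mono mult_mono) auto
    also have "\<dots> = (n + 1) * 2 * (norm x * (?S / max (norm x) (norm y)))"
      by (simp only: times_divide_eq_right times_divide_eq_left mult_ac)
    also have "\<dots> \<le> (n + 1) * 2 powr n * (norm x * (?S / max (norm x) (norm y)))"
      using C2 n S m by (intro mult_right_mono mult_left_mono mult_nonneg_nonneg divide_nonneg_nonneg) auto
    finally show ?thesis .
  next
    case 3
    define K' where "K' z h = h $ i * reg_powr \<epsilon> (- n / 2) z
      + 2 * (- n / 2) * z $ i * (z \<bullet> h) * reg_powr \<epsilon> (- n / 2 - 1) z" for z h :: "real ^ 'n"
    have K': "(K has_derivative K' z) (at z)" for z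
      using has_derivative_vec_nth_mult_reg_powr[OF \<epsilon>, where i = i and r = "- n / 2" and x = 0 and y = z]
      by (simp add: K_def K'_def[abs_def])
    let ?B = "(n + 1) * 2 powr n * (norm x * norm y powr - n)"
    have "\<bar>K (y + 1 *\<^sub>R (- x)) - K y\<bar> \<le> 1 * ?B"
    proof (rule diff_along_line_le[OF K'])
      fix s :: real assume s: "0 \<le> s" "s \<le> 1"
      define z where "z = y + s *\<^sub>R - x"
      have "norm y \<le> norm z + s * norm x"
        using norm_triangle_ineq[of z "s *\<^sub>R x"] s by (simp add: z_def)
      moreover have "s * norm x \<le> 1 * norm x" using s by (intro mult_right_mono) auto
      ultimately have z: "norm y / 2 \<le> norm z" using 3 by linarith
      have z0: "z \<noteq> 0" using z 3 by auto
      let ?P = "reg_powr \<epsilon> (- n / 2) z" and ?P1 = "reg_powr \<epsilon> (- n / 2 - 1) z"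
      have P: "0 \<le> ?P" "0 \<le> ?P1" by (rule reg_powr_nonneg)+
      \<comment> \<open>Since |z|^2 is at most the base, the extra power gained by differentiating
        is paid for by |z|^2, and both terms of the derivative are of the size of \<open>?P\<close>
        times |x|.\<close>
      have zz: "norm z * norm z * ?P1 \<le> ?P"
        using inner_self_mult_reg_powr[OF \<epsilon>, of z "- n / 2"] P
        by (simp add: dot_square_norm power2_eq_square)
      have "\<bar>z $ i * (z \<bullet> (- x)) * ?P1\<bar> \<le> norm z * (norm z * norm x) * ?P1"
        using P Cauchy_Schwarz_ineq2[of z "- x"] component_le_norm_cart[of z i]
        by (simp only: abs_mult abs_of_nonneg) (intro mult_right_mono mult_mono, auto)
      also have "\<dots> = norm x * (norm z * norm z * ?P1)" by simp
      also have "\<dots> \<le> norm x * ?P" by (intro mult_left_mono zz) simp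
      finally have 1: "\<bar>z $ i * (z \<bullet> (- x)) * ?P1\<bar> \<le> norm x * ?P" .
      have 2: "\<bar>(- x) $ i * ?P\<bar> \<le> norm x * ?P"
        using P component_le_norm_cart[of x i] by (simp add: abs_mult mult_right_mono)
      have "K' z (- x) = (- x) $ i * ?P - n * (z $ i * (z \<bullet> (- x)) * ?P1)"
        by (simp add: K'_def)
      then have "\<bar>K' z (- x)\<bar> \<le> \<bar>(- x) $ i * ?P\<bar> + \<bar>n * (z $ i * (z \<bullet> (- x)) * ?P1)\<bar>"
        by (simp only: abs_triangle_ineq4)
      also have "\<dots> \<le> norm x * ?P + n * (norm x * ?P)"
        using 1 2 n by (simp only: abs_mult[of n] abs_of_nonneg) (intro add_mono mult_left_mono, auto)
      also have "\<dots> = (n + 1) * (norm x * ?P)" by (simp add: algebra_simps)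
      also have "\<dots> \<le> (n + 1) * (norm x * (norm y / 2) powr - n)"
      proof (intro mult_left_mono)
        have "?P \<le> norm z powr - n" using z0 n by (intro reg_powr_le_norm_powr) auto
        also have "\<dots> \<le> (norm y / 2) powr - n" using z 3 n by (intro powr_mono2') auto
        finally show "?P \<le> (norm y / 2) powr - n" .
      qed (use n in auto)
      also have "\<dots> = ?B" by (simp add: powr_divide powr_minus field_simps)
      finally show "\<bar>K' (y + s *\<^sub>R - x) (- x)\<bar> \<le> ?B" by (simp add: z_def)
    qed simp
    also have "1 * ?B = (n + 1) * 2 powr n * (norm x * (norm y powr - (n - 1) / max (norm x) (norm y)))"
    proof -
      have "norm y powr - n = norm y powr - (n - 1) / norm y"
        using 3 powr_add[of "norm y" "- n" 1] by simp
      moreover have "max (norm x) (norm y) = norm y"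
        using 3(1) norm_ge_zero[of x] by linarith
      ultimately show ?thesis by simp
    qed
    also have "\<dots> \<le> (n + 1) * 2 powr n * (norm x * (?S / max (norm x) (norm y)))"
      using n 3 by (intro mult_left_mono divide_right_mono) (auto simp: le_max_iff_disj)
    finally show ?thesis by simp
  qed simp
qed

text \<open>Stating the bound with a nonnegative integral allows an infinite right side, so kernel
  bounds uniform in \<epsilon> pass to the limit before any integrability of the limiting integrand
  is known.\<close>

lemma abs_limit_integral_le_nn_integral:
  fixes g :: "nat \<Rightarrow> 'a \<Rightarrow> real"
  assumes "(\<lambda>k. \<integral>y. g k y \<partial>M) \<longlonglongrightarrow> L" and "\<And>k y. \<bar>g k y\<bar> \<le> h y"
  shows "ennreal \<bar>L\<bar> \<le> (\<integral>\<^sup>+y. ennreal (h y) \<partial>M)"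
proof (rule LIMSEQ_le_const2)
  show "(\<lambda>k. ennreal \<bar>\<integral>y. g k y \<partial>M\<bar>) \<longlonglongrightarrow> ennreal \<bar>L\<bar>"
    by (intro tendsto_ennrealI tendsto_rabs assms)
  have "ennreal \<bar>\<integral>y. g k y \<partial>M\<bar> \<le> (\<integral>\<^sup>+y. ennreal (h y) \<partial>M)" for k
  \<comment> \<open>A non-integrable \<open>g k\<close> has integral \<open>0\<close> by convention,
    and the bound is trivial.\<close>
  proof (cases "integrable M (g k)")
    case True
    then have "ennreal \<bar>\<integral>y. g k y \<partial>M\<bar> \<le> (\<integral>\<^sup>+y. ennreal (norm (g k y)) \<partial>M)"
      using integral_norm_bound_ennreal by fastforce
    also have "\<dots> \<le> (\<integral>\<^sup>+y. ennreal (h y) \<partial>M)"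
      using assms(2) by (intro nn_integral_mono ennreal_leI) simp
    finally show ?thesis .
  qed (simp add: not_integrable_integral_eq)
  then show "\<exists>N. \<forall>k\<ge>N. ennreal \<bar>\<integral>y. g k y \<partial>M\<bar> \<le> (\<integral>\<^sup>+y. ennreal (h y) \<partial>M)" by blast
qed

lemma ptf_bounded:
  fixes u :: "real ^ 'n \<Rightarrow> real"
  assumes u: "u \<in> punctured_test_functions"
  obtains B where "0 \<le> B" "\<And>x. \<bar>u x\<bar> \<le> B"
proof -
  obtain R where R: "0 < R" "\<And>x. R < norm x \<Longrightarrow> u x = 0" using ptf_vanishes[OF u] by metis
  have "compact (u ` cball 0 R)"
    by (intro compact_continuous_image ptf_continuous[OF u]) auto
  then obtain B where B: "\<forall>z \<in> u ` cball 0 R. norm z \<le> B"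
    using compact_imp_bounded bounded_iff by metis
  show ?thesis
  proof (rule that[of "max 0 B"])
    show "\<bar>u x\<bar> \<le> max 0 B" for x
      using B R(2)[of x] by (cases "norm x \<le> R") (auto simp: le_max_iff_disj)
  qed simp
qed

text \<open>The representation of the gradient by the Laplacian, kept as a limit in \<epsilon>: each
  integral equals, up to sign, one of the approximate identity against
  \<open>partial_deriv i u\<close>. The sign is negative because the kernel is evaluated at y -
  x.\<close>

lemma tendsto_integral_kernel_laplacian:
  fixes u :: "real ^ 'n \<Rightarrow> real"
  assumes u: "u \<in> punctured_test_functions" and \<epsilon>: "\<And>k. 0 < \<epsilon> k" "\<epsilon> \<longlonglongrightarrow> 0"
  shows "(\<lambda>k. \<integral>y. (y - x) $ i * reg_powr (\<epsilon> k) (- real CARD('n) / 2) (y - x) * laplacian u y \<partial>lborel)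
    \<longlonglongrightarrow> - (kernel_mass TYPE(real ^ 'n) * partial_deriv i u x)"
proof -
  have v: "partial_deriv i u \<in> punctured_test_functions" using u by (rule ptf_partial_deriv)
  obtain B where "\<And>x. \<bar>partial_deriv i u x\<bar> \<le> B" using ptf_bounded[OF v] by metis
  from tendsto_minus[OF tendsto_integral_approximate_identity[OF ptf_continuous[OF v] this \<epsilon>, of x]]
  show ?thesis unfolding integral_kernel_laplacian[OF u \<epsilon>(1)]
    by (simp only: DIM_cart DIM_real mult_1_right)
qed

lemma ptf_laplacian:
  fixes u :: "real ^ 'n \<Rightarrow> real"
  assumes u: "u \<in> punctured_test_functions"
  shows ptf_laplacian_continuous: "continuous_on S (laplacian u)"
    and ptf_laplacian_vanishes: "\<exists>r R. 0 < r \<and> 0 < R \<and> (\<forall>x. norm x < r \<or> R < norm x \<longrightarrow> laplacian u x = 0)"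
proof -
  have v: "partial_deriv i (partial_deriv i u) \<in> punctured_test_functions" for i
    using u by (intro ptf_partial_deriv)
  show "continuous_on S (laplacian u)"
    unfolding laplacian_def[abs_def] using v by (intro continuous_intros ptf_continuous)
  have "\<forall>i. \<exists>r R. 0 < r \<and> 0 < R \<and> (\<forall>x. norm x < r \<or> R < norm x \<longrightarrow> partial_deriv i (partial_deriv i u) x = 0)"
    using ptf_vanishes[OF v] by metis
  then obtain r R where rR: "\<And>i. 0 < r i" "\<And>i. 0 < R i"
    "\<And>i x. norm x < r i \<or> R i < norm x \<Longrightarrow> partial_deriv i (partial_deriv i u) x = 0" by metis
  have "0 < Min (range r)" "0 < Max (range R)" using rR(1,2) by (auto simp: Max_gr_iff)
  moreover have "laplacian u x = 0" if "norm x < Min (range r) \<or> Max (range R) < norm x" for x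
    unfolding laplacian_def using rR(3) that by (intro sum.neutral) auto
  ultimately show "\<exists>r R. 0 < r \<and> 0 < R \<and> (\<forall>x. norm x < r \<or> R < norm x \<longrightarrow> laplacian u x = 0)" by metis
qed

lemma norm_gradient_le_of_partials:
  assumes "\<And>i::'n::finite. ennreal (c * \<bar>partial_deriv i u x\<bar>) \<le> B" "0 < c"
  shows "ennreal (norm (gradient u x)) \<le> ennreal (real CARD('n) / c) * B"
proof -
  have "norm (gradient u x) \<le> (\<Sum>i\<in>UNIV. \<bar>partial_deriv i u x\<bar>)"
    using norm_le_l1_cart[of "gradient u x"] by (simp add: gradient_def)
  then have "ennreal (norm (gradient u x)) \<le> ennreal (\<Sum>i\<in>UNIV. \<bar>partial_deriv i u x\<bar>)" by (rule ennreal_leI)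
  also have "\<dots> = (\<Sum>i\<in>UNIV. ennreal (1 / c) * ennreal (c * \<bar>partial_deriv i u x\<bar>))"
    using assms(2) by (simp add: ennreal_mult'[symmetric])
  also have "\<dots> \<le> (\<Sum>i\<in>(UNIV::'n set). ennreal (1 / c) * B)"
    by (intro sum_mono mult_left_mono assms) auto
  also have "\<dots> = ennreal (real CARD('n) / c) * B"
    using assms(2) by (simp add: ennreal_of_nat_eq_real_of_nat ennreal_mult'[symmetric] mult.assoc[symmetric])
  finally show ?thesis .
qed

text \<open>The constant is N divided by the kernel mass, where N is the price of estimating the
  norm by the sum of the partial derivatives.\<close>

lemma norm_gradient_le_laplacian:
  obtains C where "0 < C"
    "\<And>(u :: real ^ 'n \<Rightarrow> real) x. u \<in> punctured_test_functions \<Longrightarrow> ennreal (norm (gradient u x)) \<le>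
       ennreal C * (\<integral>\<^sup>+y. ennreal (norm (x - y) powr - (real CARD('n) - 1) * \<bar>laplacian u y\<bar>) \<partial>lborel)"
proof (rule that)
  let ?m = "kernel_mass TYPE(real ^ 'n)"
  have m: "0 < ?m" by (rule kernel_mass_pos)
  then show "0 < real CARD('n) / ?m" by simp
  fix u :: "real ^ 'n \<Rightarrow> real" and x :: "real ^ 'n" assume u: "u \<in> punctured_test_functions"
  show "ennreal (norm (gradient u x)) \<le> ennreal (real CARD('n) / ?m)
      * (\<integral>\<^sup>+y. ennreal (norm (x - y) powr - (real CARD('n) - 1) * \<bar>laplacian u y\<bar>) \<partial>lborel)"
  proof (rule norm_gradient_le_of_partials[OF _ m])
    fix i
    have "ennreal \<bar>- (?m * partial_deriv i u x)\<bar>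
      \<le> (\<integral>\<^sup>+y. ennreal (norm (x - y) powr - (real CARD('n) - 1) * \<bar>laplacian u y\<bar>) \<partial>lborel)"
    proof (rule abs_limit_integral_le_nn_integral[OF tendsto_integral_kernel_laplacian[OF u]])
      show "(\<lambda>k. inverse (real (Suc k))) \<longlonglongrightarrow> 0" by (rule LIMSEQ_inverse_real_of_nat)
      show "\<bar>(y - x) $ i * reg_powr e (- real CARD('n) / 2) (y - x) * laplacian u y\<bar>
         \<le> norm (x - y) powr - (real CARD('n) - 1) * \<bar>laplacian u y\<bar>" for e y
        unfolding abs_mult[of _ "laplacian u y"] norm_minus_commute[of x]
        by (intro mult_right_mono abs_kernel_le) simp
    qed simp
    then show "ennreal (?m * \<bar>partial_deriv i u x\<bar>)
      \<le> (\<integral>\<^sup>+y. ennreal (norm (x - y) powr - (real CARD('n) - 1) * \<bar>laplacian u y\<bar>) \<partial>lborel)"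
      using m by (simp add: abs_mult)
  qed
qed

text \<open>Since \<open>\<nabla>u\<close> vanishes at the origin, the kernel may be replaced by its increment, which decays one
  order faster at infinity.\<close>

lemma norm_gradient_le_laplacian_increment:
  obtains C where "0 < C"
    "\<And>(u :: real ^ 'n \<Rightarrow> real) x. u \<in> punctured_test_functions \<Longrightarrow> ennreal (norm (gradient u x)) \<le>
       ennreal (C * norm x) * (\<integral>\<^sup>+y. ennreal ((norm (x - y) powr - (real CARD('n) - 1) + norm y powr - (real CARD('n) - 1))
          / max (norm x) (norm y) * \<bar>laplacian u y\<bar>) \<partial>lborel)"
proof (rule that)
  let ?m = "kernel_mass TYPE(real ^ 'n)" and ?n = "real CARD('n)"
  let ?C = "(?n + 1) * 2 powr ?n"
  have m: "0 < ?m" by (rule kernel_mass_pos)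
  then show "0 < ?n / ?m * ?C" by (simp add: add_pos_pos)
  fix u :: "real ^ 'n \<Rightarrow> real" and x :: "real ^ 'n" assume u: "u \<in> punctured_test_functions"
  let ?k = "\<lambda>y. (norm (x - y) powr - (?n - 1) + norm y powr - (?n - 1)) / max (norm x) (norm y)"
  let ?I = "\<integral>\<^sup>+y. ennreal (?k y * \<bar>laplacian u y\<bar>) \<partial>lborel"
  have "ennreal (norm (gradient u x)) \<le> ennreal (?n / ?m) * (ennreal (?C * norm x) * ?I)"
  proof (rule norm_gradient_le_of_partials[OF _ m])
    fix i
    define K where "K e z = z $ i * reg_powr e (- ?n / 2) z" for e and z :: "real ^ 'n"
    define \<epsilon> where "\<epsilon> k = inverse (real (Suc k))" for k
    have \<epsilon>: "0 < \<epsilon> k" for k by (simp add: \<epsilon>_def)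
    have \<epsilon>0: "\<epsilon> \<longlonglongrightarrow> 0" unfolding \<epsilon>_def by (rule LIMSEQ_inverse_real_of_nat)
    have lim: "(\<lambda>k. \<integral>y. K (\<epsilon> k) (y - x) * laplacian u y \<partial>lborel) \<longlonglongrightarrow> - (?m * partial_deriv i u x)" for x
      unfolding K_def by (rule tendsto_integral_kernel_laplacian[OF u \<epsilon> \<epsilon>0])
    have int: "integrable lborel (\<lambda>y. K (\<epsilon> k) (y - x) * laplacian u y)" for k x
    proof -
      obtain R where R: "\<And>x. R < norm x \<Longrightarrow> laplacian u x = 0" using ptf_laplacian_vanishes[OF u] by metis
      show ?thesis unfolding K_def using R
        by (intro integrable_continuous_bounded_support[where R = R] continuous_intros \<epsilon> ptf_laplacian_continuous[OF u]) auto
    qed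
    have "partial_deriv i u 0 = 0" using ptf_vanishes[OF ptf_partial_deriv[OF u, of i]] by (metis norm_zero)
    then have "(\<lambda>k. (\<integral>y. K (\<epsilon> k) (y - x) * laplacian u y \<partial>lborel) - (\<integral>y. K (\<epsilon> k) (y - 0) * laplacian u y \<partial>lborel))
        \<longlonglongrightarrow> - (?m * partial_deriv i u x)"
      using tendsto_diff[OF lim[of x] lim[of 0]] by simp
    then have "(\<lambda>k. \<integral>y. K (\<epsilon> k) (y - x) * laplacian u y - K (\<epsilon> k) (y - 0) * laplacian u y \<partial>lborel)
        \<longlonglongrightarrow> - (?m * partial_deriv i u x)"
      by (simp only: Bochner_Integration.integral_diff[OF int int])
    then have "ennreal \<bar>- (?m * partial_deriv i u x)\<bar> \<le> (\<integral>\<^sup>+y. ennreal (?C * (norm x * ?k y) * \<bar>laplacian u y\<bar>) \<partial>lborel)"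
    proof (rule abs_limit_integral_le_nn_integral)
      fix k y
      have "\<bar>K (\<epsilon> k) (y - x) - K (\<epsilon> k) y\<bar> * \<bar>laplacian u y\<bar> \<le> ?C * (norm x * ?k y) * \<bar>laplacian u y\<bar>"
        unfolding K_def by (intro mult_right_mono abs_kernel_diff_le \<epsilon>) simp
      then show "\<bar>K (\<epsilon> k) (y - x) * laplacian u y - K (\<epsilon> k) (y - 0) * laplacian u y\<bar> \<le> ?C * (norm x * ?k y) * \<bar>laplacian u y\<bar>"
        by (simp add: abs_mult[symmetric] left_diff_distrib)
    qed
    also have "\<dots> = (\<integral>\<^sup>+y. ennreal (?C * norm x) * ennreal (?k y * \<bar>laplacian u y\<bar>) \<partial>lborel)"
      by (intro nn_integral_cong) (simp add: ennreal_mult'[symmetric] mult_ac)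
    also have "\<dots> = ennreal (?C * norm x) * ?I"
      using borel_measurable_continuous_onI[OF ptf_laplacian_continuous[OF u]]
      by (intro nn_integral_cmult) measurable
    finally show "ennreal (?m * \<bar>partial_deriv i u x\<bar>) \<le> ennreal (?C * norm x) * ?I"
      using m by (simp add: abs_mult)
  qed
  then show "ennreal (norm (gradient u x)) \<le> ennreal (?n / ?m * ?C * norm x) * ?I"
    using m by (simp add: ennreal_mult'[symmetric] mult.assoc[symmetric])
qed

section \<open>A Hardy inequality\<close>

text \<open>Where \<open>h\<close> is nonzero, |x| is at least r, so it may be replaced by
  \<open>max r (norm x)\<close>, whose powers are continuous. Any real exponent is allowed, which
  settles the integrability of the weighted integrands below.\<close>

lemma vanishing_mult_norm_powr:
  fixes h :: "'a::euclidean_space \<Rightarrow> real"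
  assumes h: "continuous_on UNIV h" and "0 < r"
    and 0: "\<And>x. norm x < r \<Longrightarrow> h x = 0" "\<And>x. R < norm x \<Longrightarrow> h x = 0"
  shows "continuous_on UNIV (\<lambda>x. h x * norm x powr c)"
    and "integrable lborel (\<lambda>x. h x * norm x powr c)"
proof -
  have eq: "(\<lambda>x. h x * norm x powr c) = (\<lambda>x. h x * max r (norm x) powr c)"
    using 0(1) by (auto simp: fun_eq_iff max_def not_le)
  show cont: "continuous_on UNIV (\<lambda>x. h x * norm x powr c)"
    unfolding eq using \<open>0 < r\<close> by (intro continuous_intros h) (auto simp: max_def)
  show "integrable lborel (\<lambda>x. h x * norm x powr c)"
    by (rule integrable_continuous_bounded_support[OF cont, of R]) (simp add: 0)
qed

lemma continuous_on_gradient_ptf: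
  "u \<in> punctured_test_functions \<Longrightarrow> continuous_on S (gradient u)"
  unfolding gradient_def[abs_def] by (intro continuous_on_vec_lambda ptf_continuous ptf_partial_deriv)

lemma ptf_gradient_vanishes:
  fixes u :: "real ^ 'n \<Rightarrow> real"
  assumes u: "u \<in> punctured_test_functions"
  obtains r R where "0 < r" "0 < R" "\<And>x. norm x < r \<Longrightarrow> u x = 0" "\<And>x. R < norm x \<Longrightarrow> u x = 0"
    "\<And>x. norm x < r \<Longrightarrow> gradient u x = 0" "\<And>x. R < norm x \<Longrightarrow> gradient u x = 0"
proof -
  obtain r R where rR: "0 < r" "0 < R" "\<And>x. norm x < r \<Longrightarrow> u x = 0" "\<And>x. R < norm x \<Longrightarrow> u x = 0"
    using ptf_vanishes[OF u] by metis
  have z: "gradient u x = 0" if "open S" "x \<in> S" "\<And>y. y \<in> S \<Longrightarrow> u y = 0" for x S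
  proof -
    have "gradient u x \<bullet> h = 0" for h
      using has_derivative_zero_outside[OF ptf_has_derivative[OF u] that] by simp
    then show ?thesis using inner_eq_zero_iff by blast
  qed
  have op: "open {x::real^'n. norm x < r}" "open {x::real^'n. R < norm x}"
    by (intro open_Collect_less continuous_intros)+
  show ?thesis
  proof (rule that[OF rR])
    show "gradient u x = 0" if "norm x < r" for x by (rule z[OF op(1)]) (use that rR(3) in auto)
    show "gradient u x = 0" if "R < norm x" for x by (rule z[OF op(2)]) (use that rR(4) in auto)
  qed
qed

lemma ptf_gradient_bounded:
  fixes u :: "real ^ 'n \<Rightarrow> real"
  assumes u: "u \<in> punctured_test_functions"
  obtains B where "0 \<le> B" "\<And>x. norm (gradient u x) \<le> B"
proof -
  obtain R where R: "0 < R" "\<And>x. R < norm x \<Longrightarrow> gradient u x = 0" using ptf_gradient_vanishes[OF u] by metis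
  have "compact (gradient u ` cball 0 R)"
    by (intro compact_continuous_image continuous_on_gradient_ptf[OF u]) auto
  then obtain B where B: "\<forall>z \<in> gradient u ` cball 0 R. norm z \<le> B"
    using compact_imp_bounded bounded_iff by metis
  show ?thesis
  proof (rule that[of "max 0 B"])
    show "norm (gradient u x) \<le> max 0 B" for x
      using B R(2)[of x] by (cases "norm x \<le> R") (auto simp: le_max_iff_disj)
  qed simp
qed

text \<open>A substitute for the derivative of t^(k + 1) that can be applied to absolute values,
  where differentiability may fail.\<close>

lemma abs_power_diff_le:
  fixes s t :: real
  assumes "0 \<le> s" "0 \<le> t"
  shows "\<bar>s ^ Suc k - t ^ Suc k\<bar> \<le> real (Suc k) * max s t ^ k * \<bar>s - t\<bar>"
proof (induction k)
  case (Suc k)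
  let ?M = "max s t"
  have "s ^ Suc (Suc k) - t ^ Suc (Suc k) = s * (s ^ Suc k - t ^ Suc k) + (s - t) * t ^ Suc k"
    by (simp add: algebra_simps)
  then have "\<bar>s ^ Suc (Suc k) - t ^ Suc (Suc k)\<bar> \<le> \<bar>s * (s ^ Suc k - t ^ Suc k)\<bar> + \<bar>(s - t) * t ^ Suc k\<bar>"
    by (simp only: abs_triangle_ineq)
  also have "\<dots> = s * \<bar>s ^ Suc k - t ^ Suc k\<bar> + \<bar>s - t\<bar> * t ^ Suc k"
    using assms by (simp only: abs_mult abs_of_nonneg zero_le_power)
  also have "\<dots> \<le> ?M * (real (Suc k) * ?M ^ k * \<bar>s - t\<bar>) + \<bar>s - t\<bar> * ?M ^ Suc k"
    using assms by (intro add_mono mult_mono Suc.IH power_mono) auto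
  also have "\<dots> = real (Suc (Suc k)) * ?M ^ Suc k * \<bar>s - t\<bar>" by (simp add: algebra_simps)
  finally show ?case .
qed simp

text \<open>The weighted integral of \<open>\<bar>v\<bar>\<^sup>N\<close> scales by a power of the dilation factor; differentiating at factor 1
  gives the radial integration by parts without differentiating \<open>\<bar>v\<bar>\<^sup>N\<close>, which for \<open>N = 1\<close> is not smooth.\<close>

lemma hardy_integral_by_parts:
  fixes v :: "real ^ 'n \<Rightarrow> real" and b :: real
  assumes v: "v \<in> punctured_test_functions" and N: "CARD('n) = Suc m"
  shows "\<bar>b\<bar> * (\<integral>x. \<bar>v x\<bar> ^ Suc m * norm x powr (b - Suc m) \<partial>lborel)
    \<le> (\<integral>x. real (Suc m) * \<bar>v x\<bar> ^ m * \<bar>gradient v x \<bullet> x\<bar> * norm x powr (b - Suc m) \<partial>lborel)"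
proof -
  let ?c = "b - real (Suc m)"
  obtain r R where r: "0 < r" and 0: "\<And>x. norm x < r \<Longrightarrow> v x = 0" "\<And>x. R < norm x \<Longrightarrow> v x = 0"
    using ptf_vanishes[OF v] by metis
  obtain B where B: "0 \<le> B" "\<And>x. \<bar>v x\<bar> \<le> B" using ptf_bounded[OF v] by metis
  obtain D where D: "0 \<le> D" "\<And>x. norm (gradient v x) \<le> D" using ptf_gradient_bounded[OF v] by metis
  have cv: "continuous_on UNIV v" using v by (rule ptf_continuous)
  have [measurable]: "v \<in> borel_measurable borel" using cv by (rule borel_measurable_continuous_onI)
  have [measurable]: "(\<lambda>x. gradient v x \<bullet> x) \<in> borel_measurable borel"
    by (intro borel_measurable_continuous_onI continuous_intros continuous_on_gradient_ptf v)
  define t where "t k = inverse (real (Suc k))" for k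
  have t: "0 < t k" "t k \<le> 1" for k by (auto simp: t_def field_simps)
  have t0: "t \<longlonglongrightarrow> 0" unfolding t_def by (rule LIMSEQ_inverse_real_of_nat)
  have t_at: "filterlim t (at 0) sequentially"
    using t0 t(1) by (auto simp: filterlim_at eventually_sequentially less_imp_neq[symmetric])
  define f where "f x = \<bar>v x\<bar> ^ Suc m * norm x powr ?c" for x
  have f: "integrable lborel f"
    unfolding f_def using 0 r by (intro vanishing_mult_norm_powr[where r = r and R = R] continuous_intros cv) auto
  have [measurable]: "f \<in> borel_measurable borel" unfolding f_def by measurable
  define G where "G l = (\<integral>x. \<bar>v (l *\<^sub>R x)\<bar> ^ Suc m * norm x powr ?c \<partial>lborel)" for l
  have G1: "G 1 = (\<integral>x. f x \<partial>lborel)" by (simp add: G_def f_def)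
  have G1_nonneg: "0 \<le> G 1" by (simp add: G_def)
  \<comment> \<open>Dilation contributes the Jacobian l^N and the weight l^(b - N), together l^b;
    differentiating the resulting power of l at 1 is what produces the factor b.\<close>
  have G: "G l = l powr - b * G 1" if "0 < l" for l
  proof -
    have fl: "f (l *\<^sub>R x) = l powr ?c * (\<bar>v (l *\<^sub>R x)\<bar> ^ Suc m * norm x powr ?c)" for x
      using that by (simp add: f_def powr_mult)
    have "G 1 = l ^ CARD('n) * (\<integral>x. f (l *\<^sub>R x) \<partial>lborel)"
      using lborel_integral_affine[of f l 0] that by (simp add: G1)
    also have "\<dots> = l ^ CARD('n) * (l powr ?c * G l)" unfolding fl G_def by simp
    also have "\<dots> = l powr (real (Suc m) + ?c) * G l"
      using that powr_realpow[of l "Suc m"] by (simp only: N powr_add mult.assoc)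
    finally have "G 1 = l powr b * G l" by simp
    then show ?thesis using that by (simp add: powr_minus field_simps)
  qed
  have lim1: "(\<lambda>k. \<bar>(G (1 + t k) - G 1) / t k\<bar>) \<longlonglongrightarrow> \<bar>- b * G 1\<bar>"
  proof (intro tendsto_rabs)
    have "((\<lambda>l. l powr - b) has_real_derivative - b * 1 powr (- b - 1)) (at 1)"
      by (rule has_real_derivative_powr) simp
    then have "((\<lambda>h. ((1 + h) powr - b - 1) / h) \<longlongrightarrow> - b) (at 0)" by (simp add: DERIV_def)
    then have "(\<lambda>k. ((1 + t k) powr - b - 1) / t k) \<longlonglongrightarrow> - b"
      using t_at by (rule filterlim_compose)
    then have "(\<lambda>k. ((1 + t k) powr - b - 1) / t k * G 1) \<longlonglongrightarrow> - b * G 1"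
      by (intro tendsto_intros)
    moreover have "((1 + t k) powr - b - 1) / t k * G 1 = (G (1 + t k) - G 1) / t k" for k
      using t(1)[of k] G[of "1 + t k"] by (simp add: field_simps)
    ultimately show "(\<lambda>k. (G (1 + t k) - G 1) / t k) \<longlonglongrightarrow> - b * G 1" by (simp only:)
  qed
  \<comment> \<open>A majorant of the difference quotient of |v|^N. It contains only the quotient of
    \<open>v\<close> itself, so its pointwise limit exists even where |v| is not
    differentiable.\<close>
  define s where "s k x = real (Suc m) * max \<bar>v ((1 + t k) *\<^sub>R x)\<bar> \<bar>v x\<bar> ^ m
      * \<bar>(v ((1 + t k) *\<^sub>R x) - v x) / t k\<bar> * norm x powr ?c" for k x
  have s_meas [measurable]: "s k \<in> borel_measurable borel" for k unfolding s_def by measurable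
  \<comment> \<open>Dilation factors lie between 1 and 2, so everything vanishes for |x| < r/2 or
    |x| > R. Cutting the weight off at r/2 makes the dominating function continuous on the
    ball.\<close>
  define W where "W x = indicator (cball 0 R) x *\<^sub>R (real (Suc m) * B ^ m * (D * norm x)
      * max (r / 2) (norm x) powr ?c)" for x :: "real ^ 'n"
  have W: "integrable lborel W"
    unfolding W_def using r by (intro borel_integrable_compact continuous_intros) (auto simp: max_def)
  have v_dil: "v ((1 + t k) *\<^sub>R x) = v (x + t k *\<^sub>R x)" for k x by (simp add: scaleR_left_distrib)
  have s_nonneg: "0 \<le> s k x" for k x
    unfolding s_def by (intro mult_nonneg_nonneg zero_le_power powr_ge_zero abs_ge_zero max.coboundedI2 of_nat_0_le_iff)
  have s_le: "norm (s k x) \<le> W x" for k x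
  proof -
    have nl: "norm ((1 + t k) *\<^sub>R x) = (1 + t k) * norm x" using t(1)[of k] by simp
    have "norm x \<le> (1 + t k) * norm x" "(1 + t k) * norm x \<le> 2 * norm x"
      using t[of k] by (auto intro: mult_right_mono simp: mult_le_cancel_right1)
    note nl2 = this[folded nl]
    consider "norm x < r / 2" | "R < norm x" | "r / 2 \<le> norm x" "norm x \<le> R" by linarith
    then show ?thesis
    proof cases
      case 1
      then have "s k x = 0" using nl2 by (simp add: s_def 0)
      moreover have "0 \<le> W x" unfolding W_def using B D by (auto simp: indicator_def)
      ultimately show ?thesis by simp
    next
      case 2
      then have "s k x = 0" using nl2 by (simp add: s_def 0)
      moreover have "W x = 0" using 2 by (simp add: W_def)
      ultimately show ?thesis by simp
    next
      case 3
      have "\<bar>v (x + t k *\<^sub>R x) - v x\<bar> \<le> t k * (D * norm x)"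
      proof (rule diff_along_line_le[OF ptf_has_derivative[OF v]])
        show "\<bar>gradient v (x + s *\<^sub>R x) \<bullet> x\<bar> \<le> D * norm x" for s
          using Cauchy_Schwarz_ineq2[of "gradient v (x + s *\<^sub>R x)" x] D(2)[of "x + s *\<^sub>R x"]
          by (meson mult_right_mono norm_ge_zero order_trans)
      qed (use t[of k] in auto)
      then have d: "\<bar>(v ((1 + t k) *\<^sub>R x) - v x) / t k\<bar> \<le> D * norm x"
        using t(1)[of k] by (simp add: v_dil field_simps)
      have "norm (s k x) = s k x" using s_nonneg[of k x] by simp
      also have "\<dots> \<le> real (Suc m) * B ^ m * (D * norm x) * max (r / 2) (norm x) powr ?c"
        unfolding s_def
      proof (intro mult_mono power_mono d)
        show "max \<bar>v ((1 + t k) *\<^sub>R x)\<bar> \<bar>v x\<bar> \<le> B" using B(2) by simp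
        show "norm x powr ?c \<le> max (r / 2) (norm x) powr ?c" using 3 by (simp add: max_absorb2)
      qed (use B D in \<open>simp_all add: max.coboundedI2\<close>)
      finally show ?thesis using 3 by (simp add: W_def)
    qed
  qed
  have s_int: "integrable lborel (s k)" for k
    by (intro Bochner_Integration.integrable_bound[OF W] AE_I2 order_trans[OF s_le]) simp_all
  have lim2: "(\<lambda>k. \<integral>x. s k x \<partial>lborel) \<longlonglongrightarrow>
      (\<integral>x. real (Suc m) * \<bar>v x\<bar> ^ m * \<bar>gradient v x \<bullet> x\<bar> * norm x powr ?c \<partial>lborel)"
  proof (rule integral_dominated_convergence[where w = W])
    show "AE x in lborel. (\<lambda>k. s k x) \<longlonglongrightarrow> real (Suc m) * \<bar>v x\<bar> ^ m * \<bar>gradient v x \<bullet> x\<bar> * norm x powr ?c"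
    proof (rule AE_I2)
      fix x
      have "((\<lambda>s. v (x + s *\<^sub>R x)) has_real_derivative gradient v x \<bullet> x) (at 0)"
        using has_real_derivative_along_line[of v "\<lambda>h. gradient v x \<bullet> h" x 0 x] ptf_has_derivative[OF v, of x] by simp
      then have "((\<lambda>h. (v (x + h *\<^sub>R x) - v x) / h) \<longlongrightarrow> gradient v x \<bullet> x) (at 0)"
        by (simp add: DERIV_def)
      then have 1: "(\<lambda>k. (v ((1 + t k) *\<^sub>R x) - v x) / t k) \<longlonglongrightarrow> gradient v x \<bullet> x"
        unfolding v_dil using t_at by (rule filterlim_compose)
      have "(\<lambda>k. (1 + t k) *\<^sub>R x) \<longlonglongrightarrow> (1 + 0) *\<^sub>R x" by (intro tendsto_intros t0)
      moreover have "isCont v x" using cv by (simp add: continuous_on_eq_continuous_at)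
      ultimately have 2: "(\<lambda>k. v ((1 + t k) *\<^sub>R x)) \<longlonglongrightarrow> v x"
        by (intro isCont_tendsto_compose[of x v]) auto
      have "(\<lambda>k. s k x) \<longlonglongrightarrow> real (Suc m) * max \<bar>v x\<bar> \<bar>v x\<bar> ^ m * \<bar>gradient v x \<bullet> x\<bar> * norm x powr ?c"
        unfolding s_def by (intro tendsto_mult tendsto_const tendsto_power tendsto_max tendsto_rabs 1 2)
      then show "(\<lambda>k. s k x) \<longlonglongrightarrow> real (Suc m) * \<bar>v x\<bar> ^ m * \<bar>gradient v x \<bullet> x\<bar> * norm x powr ?c" by simp
    qed
    show "AE x in lborel. norm (s k x) \<le> W x" for k by (intro AE_I2 s_le)
  qed (use W in auto)
  have "\<bar>(G (1 + t k) - G 1) / t k\<bar> \<le> (\<integral>x. s k x \<partial>lborel)" for k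
  proof -
    let ?g = "\<lambda>x. \<bar>v ((1 + t k) *\<^sub>R x)\<bar> ^ Suc m * norm x powr ?c"
    have "continuous_on UNIV (\<lambda>x. \<bar>v ((1 + t k) *\<^sub>R x)\<bar> ^ Suc m)"
      by (intro continuous_intros continuous_on_compose2[OF cv]) auto
    moreover have "v ((1 + t k) *\<^sub>R x) = 0" if "norm x < r / 2 \<or> R < norm x" for x
    proof -
      have nl: "norm ((1 + t k) *\<^sub>R x) = (1 + t k) * norm x" using t(1)[of k] by simp
      have "norm x \<le> (1 + t k) * norm x" "(1 + t k) * norm x \<le> 2 * norm x"
        using t[of k] by (auto intro: mult_right_mono simp: mult_le_cancel_right1)
      then show ?thesis using 0[of "(1 + t k) *\<^sub>R x"] that unfolding nl by linarith
    qed
    ultimately have g: "integrable lborel ?g"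
      using r by (intro vanishing_mult_norm_powr[where r = "r / 2" and R = R]) auto
    have "G (1 + t k) - G 1 = (\<integral>x. ?g x - f x \<partial>lborel)"
      unfolding G1 by (simp only: G_def Bochner_Integration.integral_diff[OF g f])
    then have "(G (1 + t k) - G 1) / t k = (\<integral>x. (?g x - f x) / t k \<partial>lborel)" by simp
    also have "\<bar>\<dots>\<bar> \<le> (\<integral>x. \<bar>(?g x - f x) / t k\<bar> \<partial>lborel)" by (rule integral_abs_bound)
    also have "\<dots> \<le> (\<integral>x. s k x \<partial>lborel)"
    proof (rule integral_mono'[OF s_int])
      fix x
      let ?a = "\<bar>v ((1 + t k) *\<^sub>R x)\<bar>" and ?b = "\<bar>v x\<bar>"
      have "\<bar>?a ^ Suc m - ?b ^ Suc m\<bar> \<le> real (Suc m) * max ?a ?b ^ m * \<bar>?a - ?b\<bar>"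
        by (rule abs_power_diff_le) auto
      also have "\<dots> \<le> real (Suc m) * max ?a ?b ^ m * \<bar>v ((1 + t k) *\<^sub>R x) - v x\<bar>"
        by (intro mult_left_mono abs_triangle_ineq3) (simp add: le_max_iff_disj)
      finally have "\<bar>?a ^ Suc m - ?b ^ Suc m\<bar> / t k * norm x powr ?c
          \<le> real (Suc m) * max ?a ?b ^ m * \<bar>v ((1 + t k) *\<^sub>R x) - v x\<bar> / t k * norm x powr ?c"
        using t(1)[of k] by (intro mult_right_mono divide_right_mono) auto
      moreover have "\<bar>(?g x - f x) / t k\<bar> = \<bar>?a ^ Suc m - ?b ^ Suc m\<bar> / t k * norm x powr ?c"
        using t(1)[of k] unfolding f_def left_diff_distrib[symmetric] abs_divide abs_mult by simp
      moreover have "s k x = real (Suc m) * max ?a ?b ^ m * \<bar>v ((1 + t k) *\<^sub>R x) - v x\<bar> / t k * norm x powr ?c"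
        by (simp only: s_def abs_divide abs_of_pos[OF t(1)] times_divide_eq_right)
      ultimately show "\<bar>(?g x - f x) / t k\<bar> \<le> s k x" by (simp only:)
      show "0 \<le> s k x" by (rule s_nonneg)
    qed
    finally show ?thesis .
  qed
  then have "\<bar>- b * G 1\<bar> \<le> (\<integral>x. real (Suc m) * \<bar>v x\<bar> ^ m * \<bar>gradient v x \<bullet> x\<bar> * norm x powr ?c \<partial>lborel)"
    by (intro LIMSEQ_le[OF lim1 lim2]) auto
  then show ?thesis using G1_nonneg by (simp add: abs_mult G1 f_def)
qed

text \<open>Young's inequality splits the right side of the radial estimate, and half of the left
  side absorbs the term in \<open>v\<close>. The constant that results is (2 N / |b|)^N, which
  degenerates at the critical value b = 0.\<close>

lemma hardy_ptf:
  fixes b :: real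
  assumes "b \<noteq> 0"
  obtains C where "0 < C"
    "\<And>v :: real ^ 'n \<Rightarrow> real. v \<in> punctured_test_functions \<Longrightarrow>
      (\<integral>x. \<bar>v x\<bar> ^ CARD('n) * norm x powr (b - real CARD('n)) \<partial>lborel)
        \<le> C * (\<integral>x. norm (gradient v x) ^ CARD('n) * norm x powr b \<partial>lborel)"
proof -
  obtain m where N: "CARD('n) = Suc m" using not0_implies_Suc[of "CARD('n)"] by auto
  \<comment> \<open>N \<theta> = |b|/2, so that exactly half of the left side is absorbed.\<close>
  define \<theta> where "\<theta> = \<bar>b\<bar> / (2 * real (Suc m))"
  have \<theta>: "0 < \<theta>" using assms by (simp add: \<theta>_def)
  have b: "\<bar>b\<bar> = 2 * (real (Suc m) * \<theta>)" unfolding \<theta>_def by (simp del: of_nat_Suc)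
  \<comment> \<open>The product is bounded by the first term if t \<le> \<theta> s and by the second
    otherwise.\<close>
  have young: "s ^ m * t \<le> \<theta> * s ^ Suc m + t ^ Suc m / \<theta> ^ m" if "0 \<le> s" "0 \<le> t" for s t :: real
  proof (cases "t \<le> \<theta> * s")
    case True
    then have "s ^ m * t \<le> s ^ m * (\<theta> * s)" using that by (intro mult_left_mono) auto
    moreover have "0 \<le> t ^ Suc m / \<theta> ^ m" using that \<theta> by simp
    ultimately show ?thesis by (simp add: mult_ac)
  next
    case False
    then have "s \<le> t / \<theta>" using \<theta> by (simp add: field_simps)
    then have "s ^ m * t \<le> (t / \<theta>) ^ m * t" using that by (intro mult_right_mono power_mono) auto
    moreover have "0 \<le> \<theta> * s ^ Suc m" using that \<theta> by simp
    ultimately show ?thesis by (simp add: power_divide mult_ac)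
  qed
  show ?thesis
  proof (rule that)
    show "0 < 1 / (\<theta> * \<theta> ^ m)" using \<theta> by simp
    fix v :: "real ^ 'n \<Rightarrow> real" assume v: "v \<in> punctured_test_functions"
    let ?c = "b - real (Suc m)"
    obtain r R where r: "0 < r" and 0: "\<And>x. norm x < r \<Longrightarrow> v x = 0" "\<And>x. R < norm x \<Longrightarrow> v x = 0"
      "\<And>x. norm x < r \<Longrightarrow> gradient v x = 0" "\<And>x. R < norm x \<Longrightarrow> gradient v x = 0"
      using ptf_gradient_vanishes[OF v] by metis
    define f where "f x = \<bar>v x\<bar> ^ Suc m * norm x powr ?c" for x
    define g where "g x = norm (gradient v x) ^ Suc m * norm x powr b" for x
    have f: "integrable lborel f" unfolding f_def using r 0
      by (intro vanishing_mult_norm_powr[where r = r and R = R] continuous_intros ptf_continuous v) auto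
    have g: "integrable lborel g" unfolding g_def using r 0
      by (intro vanishing_mult_norm_powr[where r = r and R = R] continuous_intros continuous_on_gradient_ptf v) auto
    have "2 * (real (Suc m) * \<theta>) * integral\<^sup>L lborel f
      \<le> (\<integral>x. real (Suc m) * \<bar>v x\<bar> ^ m * \<bar>gradient v x \<bullet> x\<bar> * norm x powr ?c \<partial>lborel)"
      using hardy_integral_by_parts[OF v N, of b] by (simp add: f_def[abs_def] b)
    also have "\<dots> \<le> (\<integral>x. real (Suc m) * (\<theta> * f x + g x / \<theta> ^ m) \<partial>lborel)"
    proof (rule integral_mono')
      show "integrable lborel (\<lambda>x. real (Suc m) * (\<theta> * f x + g x / \<theta> ^ m))"
        using f g by (intro integrable_mult_right Bochner_Integration.integrable_add integrable_divide) auto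
      fix x
      have fg: "0 \<le> f x" "0 \<le> g x" by (auto simp: f_def g_def)
      then show "0 \<le> real (Suc m) * (\<theta> * f x + g x / \<theta> ^ m)" using \<theta> by simp
      let ?s = "\<bar>v x\<bar>" and ?t = "norm (gradient v x) * norm x"
      have "?s ^ m * \<bar>gradient v x \<bullet> x\<bar> \<le> ?s ^ m * ?t"
        by (intro mult_left_mono Cauchy_Schwarz_ineq2) simp
      also have "\<dots> \<le> \<theta> * ?s ^ Suc m + ?t ^ Suc m / \<theta> ^ m" by (rule young) auto
      finally have "?s ^ m * \<bar>gradient v x \<bullet> x\<bar> * norm x powr ?c \<le> (\<theta> * ?s ^ Suc m + ?t ^ Suc m / \<theta> ^ m) * norm x powr ?c"
        by (rule mult_right_mono) simp
      also have "\<dots> = \<theta> * f x + norm (gradient v x) ^ Suc m * (norm x ^ Suc m * norm x powr ?c) / \<theta> ^ m"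
        unfolding f_def power_mult_distrib by (simp add: distrib_right)
      also have "norm (gradient v x) ^ Suc m * (norm x ^ Suc m * norm x powr ?c) = g x"
      proof (cases "x = 0")
        case True then show ?thesis using 0(3)[of 0] r by (simp add: g_def)
      next
        case False
        then have "norm x ^ Suc m * norm x powr ?c = norm x powr b"
          using powr_realpow[of "norm x" "Suc m"] powr_add[of "norm x" "real (Suc m)" ?c] by simp
        then show ?thesis by (simp only: g_def)
      qed
      finally have "?s ^ m * \<bar>gradient v x \<bullet> x\<bar> * norm x powr ?c \<le> \<theta> * f x + g x / \<theta> ^ m" .
      then show "real (Suc m) * \<bar>v x\<bar> ^ m * \<bar>gradient v x \<bullet> x\<bar> * norm x powr ?c \<le> real (Suc m) * (\<theta> * f x + g x / \<theta> ^ m)"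
        unfolding mult.assoc by (intro mult_left_mono) (simp_all add: mult.assoc)
    qed
    also have "\<dots> = real (Suc m) * (\<theta> * integral\<^sup>L lborel f + integral\<^sup>L lborel g / \<theta> ^ m)"
      using f g by simp
    finally have "2 * \<theta> * integral\<^sup>L lborel f \<le> \<theta> * integral\<^sup>L lborel f + integral\<^sup>L lborel g / \<theta> ^ m"
      by (simp only: mult.assoc mult.left_commute[of 2] mult_le_cancel_left_pos of_nat_0_less_iff zero_less_Suc)
    then have "\<theta> * integral\<^sup>L lborel f \<le> integral\<^sup>L lborel g / \<theta> ^ m" by linarith
    then have "integral\<^sup>L lborel f \<le> 1 / (\<theta> * \<theta> ^ m) * integral\<^sup>L lborel g"
      using \<theta> by (simp add: field_simps)
    then show "(\<integral>x. \<bar>v x\<bar> ^ CARD('n) * norm x powr (b - real CARD('n)) \<partial>lborel)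
        \<le> 1 / (\<theta> * \<theta> ^ m) * (\<integral>x. norm (gradient v x) ^ CARD('n) * norm x powr b \<partial>lborel)"
      unfolding N f_def[abs_def] g_def[abs_def] .
  qed
qed

section \<open>The weighted estimate\<close>

lemma integrable_laplacian_weighted:
  fixes u :: "real ^ 'n \<Rightarrow> real"
  assumes u: "u \<in> punctured_test_functions"
  shows "integrable lborel (\<lambda>x. \<bar>laplacian u x\<bar> ^ CARD('n) * norm x powr a)"
proof -
  obtain r R where "0 < r" "\<And>x. norm x < r \<or> R < norm x \<Longrightarrow> laplacian u x = 0"
    using ptf_laplacian_vanishes[OF u] by metis
  then show ?thesis
    by (intro vanishing_mult_norm_powr[where r = r and R = R] continuous_intros ptf_laplacian_continuous[OF u]) auto
qed

lemma integral_le_of_nn_integral_le: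
  fixes f g :: "'a \<Rightarrow> real"
  assumes "integrable M f" "integrable M g" "\<And>x. 0 \<le> f x" "\<And>x. 0 \<le> g x" "0 \<le> C"
    and "(\<integral>\<^sup>+x. ennreal (f x) \<partial>M) \<le> ennreal C * (\<integral>\<^sup>+x. ennreal (g x) \<partial>M)"
  shows "(\<integral>x. f x \<partial>M) \<le> C * (\<integral>x. g x \<partial>M)"
  using assms by (simp add: nn_integral_eq_integral ennreal_mult'[symmetric] ennreal_le_iff)

lemma gradient_le_laplacian_weighted:
  fixes a :: real
  assumes "- real CARD('n) < a" "a < 1" "a \<noteq> 0"
  obtains C where "0 < C"
    "\<And>u :: real ^ 'n \<Rightarrow> real. u \<in> punctured_test_functions \<Longrightarrow>
      (\<integral>x. norm (gradient u x) ^ CARD('n) * norm x powr (a - real CARD('n)) \<partial>lborel)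
        \<le> C * (\<integral>x. \<bar>laplacian u x\<bar> ^ CARD('n) * norm x powr a \<partial>lborel)"
proof -
  let ?N = "CARD('n)" and ?n = "real CARD('n)"
  have int_grad: "integrable lborel (\<lambda>x. norm (gradient u x) ^ ?N * norm x powr c)"
    if u: "u \<in> punctured_test_functions" for u :: "real ^ 'n \<Rightarrow> real" and c
  proof -
    obtain r R where "0 < r" "\<And>x. norm x < r \<Longrightarrow> gradient u x = 0" "\<And>x. R < norm x \<Longrightarrow> gradient u x = 0"
      using ptf_gradient_vanishes[OF u] by metis
    then show ?thesis
      by (intro vanishing_mult_norm_powr[where r = r and R = R] continuous_intros continuous_on_gradient_ptf u) auto
  qed
  have "1 \<le> ?N" by (simp add: Suc_leI)
  then have "?N = 1 \<or> 2 \<le> ?N \<and> 0 < a \<or> 2 \<le> ?N \<and> a < 0"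
    using assms(3) by linarith
  then consider "?N = 1" | "2 \<le> ?N" "0 < a" | "2 \<le> ?N" "a < 0"
    by blast
  then show ?thesis
  proof cases
    case 1
    then obtain i :: 'n where i: "UNIV = {i}" by (metis card_1_singletonE)
    have grad: "norm (gradient u x) = \<bar>partial_deriv i u x\<bar>" for u :: "real ^ 'n \<Rightarrow> real" and x
      by (simp add: norm_vec_def L2_set_def i gradient_def)
    obtain C where C: "0 < C" "\<And>v :: real ^ 'n \<Rightarrow> real. v \<in> punctured_test_functions \<Longrightarrow>
      (\<integral>x. \<bar>v x\<bar> ^ ?N * norm x powr (a - ?n) \<partial>lborel) \<le> C * (\<integral>x. norm (gradient v x) ^ ?N * norm x powr a \<partial>lborel)"
      using hardy_ptf[OF assms(3), where 'n = 'n] by blast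
    show ?thesis
    proof (rule that[OF C(1)])
      fix u :: "real ^ 'n \<Rightarrow> real" assume u: "u \<in> punctured_test_functions"
      show "(\<integral>x. norm (gradient u x) ^ ?N * norm x powr (a - ?n) \<partial>lborel)
        \<le> C * (\<integral>x. \<bar>laplacian u x\<bar> ^ ?N * norm x powr a \<partial>lborel)"
        \<comment> \<open>With a single index the gradient of \<open>partial_deriv i u\<close> has
          norm |laplacian u|, so Hardy with b = a is already the claim.\<close>
        using C(2)[OF ptf_partial_deriv[OF u, of i]] by (simp add: grad laplacian_def i)
    qed
  next
    case 2
    obtain C1 where C1: "0 < C1" "\<And>(u :: real ^ 'n \<Rightarrow> real) x. u \<in> punctured_test_functions \<Longrightarrow> ennreal (norm (gradient u x)) \<le>
       ennreal C1 * (\<integral>\<^sup>+y. ennreal (norm (x - y) powr - (?n - 1) * \<bar>laplacian u y\<bar>) \<partial>lborel)"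
      using norm_gradient_le_laplacian[where 'n = 'n] by blast
    obtain C2 where C2: "0 < C2" "\<And>f :: real ^ 'n \<Rightarrow> real. f \<in> borel_measurable borel \<Longrightarrow> (\<And>y. 0 \<le> f y) \<Longrightarrow> f 0 = 0 \<Longrightarrow>
      (\<integral>\<^sup>+x. (\<integral>\<^sup>+y. ennreal (norm x powr - 1 * norm (x - y) powr - (?n - 1) * f y) \<partial>lborel) ^ ?N
          * ennreal (norm x powr a) \<partial>lborel)
        \<le> ennreal C2 * (\<integral>\<^sup>+y. ennreal (f y ^ ?N * norm y powr a) \<partial>lborel)"
      using nn_integral_weighted_fractional_pos[where 'a = "real ^ 'n" and a = a] 2 assms by auto
    show ?thesis
    proof (rule that)
      show "0 < C1 ^ ?N * C2" using C1 C2 by simp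
      fix u :: "real ^ 'n \<Rightarrow> real" assume u: "u \<in> punctured_test_functions"
      have [measurable]: "laplacian u \<in> borel_measurable borel"
        by (intro borel_measurable_continuous_onI ptf_laplacian_continuous u)
      let ?J = "\<lambda>x. \<integral>\<^sup>+y. ennreal (norm x powr - 1 * norm (x - y) powr - (?n - 1) * \<bar>laplacian u y\<bar>) \<partial>lborel"
      have pt: "ennreal (norm (gradient u x) ^ ?N * norm x powr (a - ?n)) \<le> ennreal (C1 ^ ?N) * (?J x ^ ?N * ennreal (norm x powr a))" for x
      proof (cases "x = 0")
        case False
        let ?I = "\<integral>\<^sup>+y. ennreal (norm (x - y) powr - (?n - 1) * \<bar>laplacian u y\<bar>) \<partial>lborel"
        have "?J x = (\<integral>\<^sup>+y. ennreal (norm x powr - 1) * ennreal (norm (x - y) powr - (?n - 1) * \<bar>laplacian u y\<bar>) \<partial>lborel)"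
          by (intro nn_integral_cong) (simp only: ennreal_mult'[symmetric] powr_ge_zero mult.assoc)
        also have "\<dots> = ennreal (norm x powr - 1) * ?I" by (intro nn_integral_cmult) measurable
        finally have J: "?J x = ennreal (norm x powr - 1) * ?I" .
        \<comment> \<open>The weight |x|^-N is spread over the N factors of the integral, which is
          why the kernel carries a factor |x|^-1.\<close>
        have "norm x powr (a - ?n) = (norm x powr - 1) ^ ?N * norm x powr a"
        proof -
          have "(norm x powr - 1) ^ ?N = norm x powr - ?n" using False by (subst powr_power) auto
          then show ?thesis by (simp only: powr_add[symmetric]) simp
        qed
        then have "ennreal (norm (gradient u x) ^ ?N * norm x powr (a - ?n))
          = ennreal (norm x powr - 1 * norm (gradient u x)) ^ ?N * ennreal (norm x powr a)"
          by (simp only: ennreal_power ennreal_mult'[symmetric] power_mult_distrib mult_nonneg_nonneg powr_ge_zero norm_ge_zero zero_le_power mult_ac)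
        also have "\<dots> \<le> (ennreal C1 * ?J x) ^ ?N * ennreal (norm x powr a)"
        proof (intro mult_right_mono power_mono)
          have "ennreal (norm x powr - 1 * norm (gradient u x)) = ennreal (norm x powr - 1) * ennreal (norm (gradient u x))"
            by (rule ennreal_mult') simp
          also have "\<dots> \<le> ennreal (norm x powr - 1) * (ennreal C1 * ?I)" by (intro mult_left_mono C1(2)[OF u]) simp
          also have "\<dots> = ennreal C1 * ?J x" unfolding J by (rule mult.left_commute)
          finally show "ennreal (norm x powr - 1 * norm (gradient u x)) \<le> ennreal C1 * ?J x" .
        qed auto
        also have "\<dots> = ennreal (C1 ^ ?N) * (?J x ^ ?N * ennreal (norm x powr a))"
          using C1(1) by (simp add: power_mult_distrib ennreal_power mult.assoc)
        finally show ?thesis .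
      qed simp
      have "(\<integral>\<^sup>+x. ennreal (norm (gradient u x) ^ ?N * norm x powr (a - ?n)) \<partial>lborel)
        \<le> (\<integral>\<^sup>+x. ennreal (C1 ^ ?N) * (?J x ^ ?N * ennreal (norm x powr a)) \<partial>lborel)"
        by (intro nn_integral_mono pt)
      also have "\<dots> = ennreal (C1 ^ ?N) * (\<integral>\<^sup>+x. ?J x ^ ?N * ennreal (norm x powr a) \<partial>lborel)"
        by (intro nn_integral_cmult) measurable
      also have "\<dots> \<le> ennreal (C1 ^ ?N) * (ennreal C2 * (\<integral>\<^sup>+y. ennreal (\<bar>laplacian u y\<bar> ^ ?N * norm y powr a) \<partial>lborel))"
        \<comment> \<open>Vanishing near the origin supplies the condition \<open>f 0 = 0\<close> of
          Schur's test.\<close>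
        using ptf_laplacian_vanishes[OF u] by (intro mult_left_mono C2(2)) auto
      also have "\<dots> = ennreal (C1 ^ ?N * C2) * (\<integral>\<^sup>+y. ennreal (\<bar>laplacian u y\<bar> ^ ?N * norm y powr a) \<partial>lborel)"
        using C1(1) by (simp add: ennreal_mult' mult.assoc)
      finally show "(\<integral>x. norm (gradient u x) ^ ?N * norm x powr (a - ?n) \<partial>lborel)
        \<le> C1 ^ ?N * C2 * (\<integral>x. \<bar>laplacian u x\<bar> ^ ?N * norm x powr a \<partial>lborel)"
        using C1(1) C2(1) by (intro integral_le_of_nn_integral_le int_grad integrable_laplacian_weighted u) auto
    qed
  next
    case 3
    obtain C1 where C1: "0 < C1" "\<And>(u :: real ^ 'n \<Rightarrow> real) x. u \<in> punctured_test_functions \<Longrightarrow> ennreal (norm (gradient u x)) \<le>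
       ennreal (C1 * norm x) * (\<integral>\<^sup>+y. ennreal ((norm (x - y) powr - (?n - 1) + norm y powr - (?n - 1))
          / max (norm x) (norm y) * \<bar>laplacian u y\<bar>) \<partial>lborel)"
      using norm_gradient_le_laplacian_increment[where 'n = 'n] by blast
    obtain C2 where C2: "0 < C2" "\<And>f :: real ^ 'n \<Rightarrow> real. f \<in> borel_measurable borel \<Longrightarrow> (\<And>y. 0 \<le> f y) \<Longrightarrow> f 0 = 0 \<Longrightarrow>
      (\<integral>\<^sup>+x. (\<integral>\<^sup>+y. ennreal ((norm (x - y) powr - (?n - 1) + norm y powr - (?n - 1)) / max (norm x) (norm y) * f y) \<partial>lborel) ^ ?N
          * ennreal (norm x powr a) \<partial>lborel)
        \<le> ennreal C2 * (\<integral>\<^sup>+y. ennreal (f y ^ ?N * norm y powr a) \<partial>lborel)"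
      using nn_integral_weighted_fractional_neg[where 'a = "real ^ 'n" and a = a] 3 assms by auto
    show ?thesis
    proof (rule that)
      show "0 < C1 ^ ?N * C2" using C1 C2 by simp
      fix u :: "real ^ 'n \<Rightarrow> real" assume u: "u \<in> punctured_test_functions"
      have [measurable]: "laplacian u \<in> borel_measurable borel"
        by (intro borel_measurable_continuous_onI ptf_laplacian_continuous u)
      let ?J = "\<lambda>x. \<integral>\<^sup>+y. ennreal ((norm (x - y) powr - (?n - 1) + norm y powr - (?n - 1)) / max (norm x) (norm y) * \<bar>laplacian u y\<bar>) \<partial>lborel"
      have pt: "ennreal (norm (gradient u x) ^ ?N * norm x powr (a - ?n)) \<le> ennreal (C1 ^ ?N) * (?J x ^ ?N * ennreal (norm x powr a))" for x
      proof (cases "x = 0")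
        case False
        \<comment> \<open>The factor |x| gained from the increment, raised to the power N, restores
          the weight |x|^a; here the kernel carries no factor |x|^-1.\<close>
        have nx: "norm x ^ ?N * norm x powr (a - ?n) = norm x powr a"
          using False powr_realpow[of "norm x" ?N] powr_add[of "norm x" ?n "a - ?n"] by simp
        have "ennreal (norm (gradient u x) ^ ?N * norm x powr (a - ?n))
          = ennreal (norm (gradient u x)) ^ ?N * ennreal (norm x powr (a - ?n))"
          by (simp add: ennreal_power ennreal_mult')
        also have "\<dots> \<le> (ennreal (C1 * norm x) * ?J x) ^ ?N * ennreal (norm x powr (a - ?n))"
          by (intro mult_right_mono power_mono C1(2)[OF u]) auto
        also have "\<dots> = ?J x ^ ?N * (ennreal ((C1 * norm x) ^ ?N) * ennreal (norm x powr (a - ?n)))"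
          using C1(1) by (simp add: power_mult_distrib ennreal_power mult_ac)
        also have "ennreal ((C1 * norm x) ^ ?N) * ennreal (norm x powr (a - ?n)) = ennreal (C1 ^ ?N * norm x powr a)"
          using C1(1) nx by (simp add: power_mult_distrib ennreal_mult'[symmetric] mult.assoc)
        also have "\<dots> = ennreal (C1 ^ ?N) * ennreal (norm x powr a)" using C1(1) by (simp add: ennreal_mult')
        finally show ?thesis by (simp only: mult.left_commute)
      qed simp
      have "(\<integral>\<^sup>+x. ennreal (norm (gradient u x) ^ ?N * norm x powr (a - ?n)) \<partial>lborel)
        \<le> (\<integral>\<^sup>+x. ennreal (C1 ^ ?N) * (?J x ^ ?N * ennreal (norm x powr a)) \<partial>lborel)"
        by (intro nn_integral_mono pt)
      also have "\<dots> = ennreal (C1 ^ ?N) * (\<integral>\<^sup>+x. ?J x ^ ?N * ennreal (norm x powr a) \<partial>lborel)"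
        by (intro nn_integral_cmult) measurable
      also have "\<dots> \<le> ennreal (C1 ^ ?N) * (ennreal C2 * (\<integral>\<^sup>+y. ennreal (\<bar>laplacian u y\<bar> ^ ?N * norm y powr a) \<partial>lborel))"
        using ptf_laplacian_vanishes[OF u] by (intro mult_left_mono C2(2)) auto
      also have "\<dots> = ennreal (C1 ^ ?N * C2) * (\<integral>\<^sup>+y. ennreal (\<bar>laplacian u y\<bar> ^ ?N * norm y powr a) \<partial>lborel)"
        using C1(1) by (simp add: ennreal_mult' mult.assoc)
      finally show "(\<integral>x. norm (gradient u x) ^ ?N * norm x powr (a - ?n) \<partial>lborel)
        \<le> C1 ^ ?N * C2 * (\<integral>x. \<bar>laplacian u x\<bar> ^ ?N * norm x powr a \<partial>lborel)"
        using C1(1) C2(1) by (intro integral_le_of_nn_integral_le int_grad integrable_laplacian_weighted u) auto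
    qed
  qed
qed

lemma norm_gradient_divide_norm_le:
  fixes u :: "real ^ 'n \<Rightarrow> real"
  assumes u: "u \<in> punctured_test_functions"
  shows "norm (gradient (\<lambda>y. u y / norm y) x) \<le> norm (gradient u x) / norm x + \<bar>u x\<bar> / (norm x)\<^sup>2"
proof -
  let ?w = "\<lambda>y. u y / norm y"
  have gradI: "gradient f x = g" if "(f has_derivative (\<lambda>h. g \<bullet> h)) (at x)" for f :: "real ^ 'n \<Rightarrow> real" and g
    using frechet_derivative_at[OF that, symmetric]
    by (simp add: gradient_def partial_deriv_def vec_eq_iff inner_axis)
  show ?thesis
  proof (cases "x = 0")
    \<comment> \<open>\<open>u\<close> vanishes near the origin and so does the quotient; the right
      side is \<open>0\<close> there since division by zero gives \<open>0\<close>.\<close>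
    case True
    obtain r where r: "0 < r" "\<And>y. norm y < r \<Longrightarrow> u y = 0" using ptf_vanishes[OF u] by metis
    have "(?w has_derivative (\<lambda>h. 0)) (at x)"
      using r True
      by (intro has_derivative_transform_within_open[OF has_derivative_const, of "ball 0 r"]) auto
    then have "gradient ?w x = 0" by (intro gradI) simp
    then show ?thesis using True by simp
  next
    case False
    have "(?w has_derivative (\<lambda>h. (gradient u x \<bullet> h * norm x - u x * (h \<bullet> sgn x)) / (norm x * norm x))) (at x)"
      using False by (intro has_derivative_divide' ptf_has_derivative[OF u] has_derivative_norm) auto
    moreover have "(\<lambda>h. (gradient u x \<bullet> h * norm x - u x * (h \<bullet> sgn x)) / (norm x * norm x))
      = (\<lambda>h. ((1 / norm x) *\<^sub>R gradient u x - (u x / (norm x)\<^sup>2) *\<^sub>R sgn x) \<bullet> h)"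
      using False by (intro ext) (simp add: inner_diff_left inner_diff_right inner_commute diff_divide_distrib power2_eq_square)
    ultimately have "gradient ?w x = (1 / norm x) *\<^sub>R gradient u x - (u x / (norm x)\<^sup>2) *\<^sub>R sgn x"
      using gradI by simp
    then show ?thesis
      using norm_triangle_ineq4[of "(1 / norm x) *\<^sub>R gradient u x" "(u x / (norm x)\<^sup>2) *\<^sub>R sgn x"] False
      by (simp add: norm_sgn)
  qed
qed

theorem corollary1p1:
  fixes a :: real
  assumes "- real CARD('n::finite) < a" and "a < 1" and "a \<noteq> 0"
  shows "\<exists>C::real. C > 0 \<and>
    (\<forall>u \<in> (punctured_test_functions :: (real ^ 'n \<Rightarrow> real) set).
      (LINT x|lborel. norm (gradient (\<lambda>y. u y / norm y) x) ^ CARD('n) * norm x powr a)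
        \<le> C * (LINT x|lborel. \<bar>laplacian u x\<bar> ^ CARD('n) * norm x powr a))"
proof -
  let ?N = "CARD('n)" and ?n = "real CARD('n)"
  have n: "1 \<le> ?n" by (simp add: Suc_leI)
  obtain C1 where C1: "0 < C1" "\<And>u :: real ^ 'n \<Rightarrow> real. u \<in> punctured_test_functions \<Longrightarrow>
      (\<integral>x. norm (gradient u x) ^ ?N * norm x powr (a - ?n) \<partial>lborel) \<le> C1 * (\<integral>x. \<bar>laplacian u x\<bar> ^ ?N * norm x powr a \<partial>lborel)"
    using gradient_le_laplacian_weighted[OF assms] by blast
  \<comment> \<open>Hardy is applied with b = a - N, which is nonzero as a < 1 \<le> N.\<close>
  have "a - ?n \<noteq> 0" using n assms(2) by linarith
  then obtain C2 where C2: "0 < C2" "\<And>v :: real ^ 'n \<Rightarrow> real. v \<in> punctured_test_functions \<Longrightarrow>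
      (\<integral>x. \<bar>v x\<bar> ^ ?N * norm x powr (a - ?n - ?n) \<partial>lborel) \<le> C2 * (\<integral>x. norm (gradient v x) ^ ?N * norm x powr (a - ?n) \<partial>lborel)"
    using hardy_ptf[where 'n = 'n] by blast
  show ?thesis
  \<comment> \<open>2^N comes from (s + t)^N \<le> 2^N (s^N + t^N), \<open>C2\<close> from Hardy for
    the term with u, and \<open>C1\<close> from the estimate of the gradient by the
    Laplacian.\<close>
  proof (intro exI[of _ "2 ^ ?N * (1 + C2) * C1"] conjI ballI)
    show "0 < 2 ^ ?N * (1 + C2) * C1" using C1 C2 by simp
    fix u :: "real ^ 'n \<Rightarrow> real" assume u: "u \<in> punctured_test_functions"
    obtain r R where r: "0 < r" and 0: "\<And>x. norm x < r \<Longrightarrow> u x = 0" "\<And>x. R < norm x \<Longrightarrow> u x = 0"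
      "\<And>x. norm x < r \<Longrightarrow> gradient u x = 0" "\<And>x. R < norm x \<Longrightarrow> gradient u x = 0"
      using ptf_gradient_vanishes[OF u] by metis
    define f where "f x = norm (gradient u x) ^ ?N * norm x powr (a - ?n)" for x
    define g where "g x = \<bar>u x\<bar> ^ ?N * norm x powr (a - ?n - ?n)" for x
    have f: "integrable lborel f" unfolding f_def using r 0
      by (intro vanishing_mult_norm_powr[where r = r and R = R] continuous_intros continuous_on_gradient_ptf u) auto
    have g: "integrable lborel g" unfolding g_def using r 0
      by (intro vanishing_mult_norm_powr[where r = r and R = R] continuous_intros ptf_continuous u) auto
    have "(\<integral>x. norm (gradient (\<lambda>y. u y / norm y) x) ^ ?N * norm x powr a \<partial>lborel)
      \<le> (\<integral>x. 2 ^ ?N * (f x + g x) \<partial>lborel)"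
    proof (rule integral_mono')
      show "integrable lborel (\<lambda>x. 2 ^ ?N * (f x + g x))" using f g by simp
      fix x :: "real ^ 'n"
      show "0 \<le> 2 ^ ?N * (f x + g x)" by (simp add: f_def g_def)
      show "norm (gradient (\<lambda>y. u y / norm y) x) ^ ?N * norm x powr a \<le> 2 ^ ?N * (f x + g x)"
      proof (cases "x = 0")
        \<comment> \<open>At the origin all weights are \<open>0\<close>, because
          \<open>0 powr\<close> is \<open>0\<close>.\<close>
        case True
        then show ?thesis by (simp add: f_def g_def)
      next
        case False
        let ?s = "norm (gradient u x) / norm x" and ?t = "\<bar>u x\<bar> / (norm x)\<^sup>2"
        have "norm (gradient (\<lambda>y. u y / norm y) x) \<le> 2 * max ?s ?t"
          using norm_gradient_divide_norm_le[OF u, of x] by linarith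
        then have "norm (gradient (\<lambda>y. u y / norm y) x) ^ ?N \<le> (2 * max ?s ?t) ^ ?N"
          by (intro power_mono) auto
        also have "\<dots> \<le> 2 ^ ?N * (?s ^ ?N + ?t ^ ?N)"
          unfolding power_mult_distrib by (intro mult_left_mono) (auto simp: max_def)
        finally have "norm (gradient (\<lambda>y. u y / norm y) x) ^ ?N * norm x powr a \<le> 2 ^ ?N * (?s ^ ?N + ?t ^ ?N) * norm x powr a"
          by (rule mult_right_mono) simp
        also have "\<dots> = 2 ^ ?N * (f x + g x)"
        proof -
          have p: "norm x powr (c - ?n) = norm x powr c / norm x ^ ?N" for c
            using False by (simp add: powr_diff powr_realpow)
          show ?thesis
            unfolding f_def g_def p by (simp add: power_divide power2_eq_square power_mult_distrib distrib_left distrib_right)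
        qed
        finally show ?thesis .
      qed
    qed
    also have "\<dots> = 2 ^ ?N * (integral\<^sup>L lborel f + integral\<^sup>L lborel g)" using f g by simp
    also have "\<dots> \<le> 2 ^ ?N * (integral\<^sup>L lborel f + C2 * integral\<^sup>L lborel f)"
      using C2(2)[OF u] by (simp add: f_def[abs_def] g_def[abs_def])
    also have "\<dots> = 2 ^ ?N * (1 + C2) * integral\<^sup>L lborel f" by (simp add: algebra_simps)
    also have "\<dots> \<le> 2 ^ ?N * (1 + C2) * (C1 * (\<integral>x. \<bar>laplacian u x\<bar> ^ ?N * norm x powr a \<partial>lborel))"
      using C1(2)[OF u] C2(1) by (intro mult_left_mono) (auto simp: f_def[abs_def])
    finally show "(LINT x|lborel. norm (gradient (\<lambda>y. u y / norm y) x) ^ ?N * norm x powr a)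
        \<le> 2 ^ ?N * (1 + C2) * C1 * (LINT x|lborel. \<bar>laplacian u x\<bar> ^ ?N * norm x powr a)"
      by (simp only: mult.assoc)
  qed
qed

end
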